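(* Let $m,n,d\ge 1$, $1\le s\le d$, $\epsilon>0$. Suppose machine $i\in\{1,\dots,m\}$ holds $\boldsymbol X_i=[\boldsymbol X_{i1},\dots,\boldsymbol X_{in}]$, where all $\boldsymbol X_{ij}\in\mathbb R^d$ are i.i.d. $N(\boldsymbol\mu,\boldsymbol I_d)$, the mean $\boldsymbol\mu\in\mathbb R^d$ is $s$-sparse ($\|\boldsymbol\mu\|_0\le s$) and $\|\boldsymbol\mu\|_\infty\le1$. Then, in the untrusted central server federated learning setting described in the context, there exists an $\epsilon$-differentially private algorithm producing an estimator $\hat{\boldsymbol\mu}$ of $\boldsymbol\mu$ such that $$\mathbb E\,\|\boldsymbol\mu-\hat{\boldsymbol\mu}\|_2^2\ \le\ c\cdot\frac{s\,d}{mn\epsilon^2},$$ where $c>0$ is some constant.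
   Context: $\|\boldsymbol v\|_0$ is the number of non-zero coordinates of $\boldsymbol v$. Untrusted central server setting: there are $m$ local machines and one central server. Each local machine communicates only with the central server (no communication between local machines), possibly over multiple rounds. Let $\mathcal X=\mathbb R^d$. Machine $i$ uses a privacy channel (randomized map) $\mathcal W_i^{\epsilon\text{-priv}}:\mathcal X^n\to\mathcal Z$ which takes its data $\boldsymbol X_i$ and produces $\boldsymbol Z_i\in\mathcal Z$, representing all the information transmitted by machine $i$ to the server. The channel must be $\epsilon$-differentially private: for any two data sets $X,X'\in\mathcal X^n$ differing in only one data point and any output $Z$, $\mathbb P(\mathcal W_i^{\epsilon\text{-priv}}(X)=Z)\le e^{\epsilon}\,\mathbb P(\mathcal W_i^{\epsilon\text{-priv}}(X')=Z)$ (for non-discrete outputs: the same inequality for the probabilities of every measurable set of outputs). The central server outputs $\hat{\boldsymbol\mu}\in\mathbb R^d$ based on $\boldsymbol Z_1,\dots,\boldsymbol Z_m$. An algorithm of this form is what is meant by an $\epsilon$-differentially private algorithm in this setting. The expectation is over the data and the randomness of the algorithm.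
   Formalization: The constant c is uniform in m, n, d, s, μ but depends on an upper bound ε₀ for ε; with one c for all ε>0 the claim fails, since for m=n=d=s=1 the right side tends to 0 as ε→∞ while the minimax risk stays positive. *)

theory Defs
  imports "HOL-Probability.Probability"
begin

text \<open>
  The dimension, the sample size and the number of machines are numbers that vary inside a
  statement, so a vector of dimension \<open>d\<close> is an extensional function on \<open>{..<d}\<close>, a data set
  of \<open>n\<close> points an extensional function on \<open>{..<n}\<close>, and so on.
\<close>

type_synonym vec = "nat \<Rightarrow> real"
type_synonym dataset = "nat \<Rightarrow> vec"

definition vec_space :: "nat \<Rightarrow> vec measure" where
  "vec_space d = (\<Pi>\<^sub>M k\<in>{..<d}. borel)"

definition data_space :: "nat \<Rightarrow> nat \<Rightarrow> dataset measure" where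
  "data_space n d = (\<Pi>\<^sub>M j\<in>{..<n}. vec_space d)"

definition l0_norm :: "nat \<Rightarrow> vec \<Rightarrow> nat" where
  "l0_norm d v = card {k \<in> {..<d}. v k \<noteq> 0}"

definition linf_norm :: "nat \<Rightarrow> vec \<Rightarrow> real" where
  "linf_norm d v = (MAX k\<in>{..<d}. \<bar>v k\<bar>)"

text \<open>The normal distribution with mean \<open>\<mu>\<close> and identity covariance.\<close>

definition std_gaussian :: "nat \<Rightarrow> vec \<Rightarrow> vec measure" where
  "std_gaussian d \<mu> = (\<Pi>\<^sub>M k\<in>{..<d}. density lborel (normal_density (\<mu> k) 1))"

definition data_law :: "nat \<Rightarrow> nat \<Rightarrow> nat \<Rightarrow> vec \<Rightarrow> (nat \<Rightarrow> dataset) measure" where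
  "data_law m n d \<mu> = (\<Pi>\<^sub>M i\<in>{..<m}. \<Pi>\<^sub>M j\<in>{..<n}. std_gaussian d \<mu>)"

text \<open>
  A view \<open>(a, b)\<close> before round \<open>t\<close> records the communication so far between the server and the
  machines in a set \<open>I\<close>: \<open>a i k\<close> is the message from the server to machine \<open>i\<close> in round
  \<open>k < t\<close>, and \<open>b i k\<close> is the reply of machine \<open>i\<close>.
\<close>

type_synonym ('q, 'z) view = "(nat \<Rightarrow> nat \<Rightarrow> 'q) \<times> (nat \<Rightarrow> nat \<Rightarrow> 'z)"

definition view_space ::
  "'q measure \<Rightarrow> 'z measure \<Rightarrow> nat set \<Rightarrow> nat \<Rightarrow> ('q, 'z) view measure" where
  "view_space Q Z I t =
     (\<Pi>\<^sub>M i\<in>I. \<Pi>\<^sub>M k\<in>{..<t}. Q) \<Otimes>\<^sub>M (\<Pi>\<^sub>M i\<in>I. \<Pi>\<^sub>M k\<in>{..<t}. Z)"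

text \<open>
  In round \<open>t\<close> a server draws its messages, one for each machine in \<open>I\<close>, from a distribution that
  depends on its view. A machine draws its reply from a distribution that depends on its own data,
  the messages it has received (those of rounds \<open>0..t\<close>) and the replies it has sent (those of
  rounds \<open>0..<t\<close>), independently of the other machines.
\<close>

type_synonym ('q, 'z) server = "nat \<Rightarrow> ('q, 'z) view \<Rightarrow> (nat \<Rightarrow> 'q) measure"
type_synonym ('q, 'z) machine =
  "nat \<Rightarrow> dataset \<times> (nat \<Rightarrow> 'q) \<times> (nat \<Rightarrow> 'z) \<Rightarrow> 'z measure"

definition is_server ::
  "'q measure \<Rightarrow> 'z measure \<Rightarrow> nat set \<Rightarrow> nat \<Rightarrow> ('q, 'z) server \<Rightarrow> bool" where
  "is_server Q Z I T S \<longleftrightarrow>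
     (\<forall>t<T. S t \<in> view_space Q Z I t \<rightarrow>\<^sub>M prob_algebra (\<Pi>\<^sub>M i\<in>I. Q))"

definition is_machine ::
  "'q measure \<Rightarrow> 'z measure \<Rightarrow> nat \<Rightarrow> nat \<Rightarrow> nat \<Rightarrow> ('q, 'z) machine \<Rightarrow> bool" where
  "is_machine Q Z n d T W \<longleftrightarrow>
     (\<forall>t<T. W t \<in> data_space n d \<Otimes>\<^sub>M (\<Pi>\<^sub>M k\<in>{..<Suc t}. Q) \<Otimes>\<^sub>M (\<Pi>\<^sub>M k\<in>{..<t}. Z)
        \<rightarrow>\<^sub>M prob_algebra Z)"

text \<open>
  The law of the view after \<open>t\<close> rounds between server \<open>S\<close> and the machines \<open>W i\<close> for \<open>i \<in> I\<close>,
  where machine \<open>i\<close> holds the data set \<open>X i\<close>.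
\<close>

primrec transcript ::
  "'q measure \<Rightarrow> 'z measure \<Rightarrow> nat set \<Rightarrow> ('q, 'z) server \<Rightarrow> (nat \<Rightarrow> ('q, 'z) machine) \<Rightarrow>
   (nat \<Rightarrow> dataset) \<Rightarrow> nat \<Rightarrow> ('q, 'z) view measure" where
  "transcript Q Z I S W X 0 =
     return (view_space Q Z I 0) (\<lambda>i\<in>I. \<lambda>k. undefined, \<lambda>i\<in>I. \<lambda>k. undefined)"
| "transcript Q Z I S W X (Suc t) =
     transcript Q Z I S W X t \<bind> (\<lambda>(a, b). S t (a, b) \<bind> (\<lambda>q.
       let a' = (\<lambda>i\<in>I. (a i)(t := q i)) in
       (\<Pi>\<^sub>M i\<in>I. W i t (X i, a' i, b i)) \<bind> (\<lambda>z.
         return (view_space Q Z I (Suc t)) (a', \<lambda>i\<in>I. (b i)(t := z i)))))"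

definition neighbours :: "nat \<Rightarrow> dataset \<Rightarrow> dataset \<Rightarrow> bool" where
  "neighbours n x x' \<longleftrightarrow> (\<exists>j<n. \<forall>l<n. l \<noteq> j \<longrightarrow> x l = x' l)"

text \<open>
  Privacy of the channel from the data of machine \<open>i\<close> to all that it transmits in \<open>T\<close> rounds.
  The server is untrusted and its messages may depend on earlier replies, so the guarantee is
  against every server. To ask for it only along each fixed sequence of server messages would be
  too weak when replies are not discrete: a machine that reveals its data whenever the server
  echoes its previous, continuously distributed reply would pass. If there is one round and the
  server sends nothing, this is the usual definition for a channel from data sets to outputs.
\<close>

definition private_machine ::
  "real \<Rightarrow> 'q measure \<Rightarrow> 'z measure \<Rightarrow> nat \<Rightarrow> nat \<Rightarrow> nat \<Rightarrow> nat \<Rightarrow> ('q, 'z) machine \<Rightarrow> bool" where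
  "private_machine \<epsilon> Q Z n d T i W \<longleftrightarrow>
     (\<forall>S. is_server Q Z {i} T S \<longrightarrow>
       (\<forall>x\<in>space (data_space n d). \<forall>x'\<in>space (data_space n d). neighbours n x x' \<longrightarrow>
         (\<forall>A\<in>sets (view_space Q Z {i} T).
            emeasure (transcript Q Z {i} S (\<lambda>_. W) (\<lambda>_. x) T) A \<le>
            ennreal (exp \<epsilon>) * emeasure (transcript Q Z {i} S (\<lambda>_. W) (\<lambda>_. x') T) A)))"

record ('q, 'z) fed_algorithm =
  rounds :: nat
  server_msgs :: "'q measure"
  machine_msgs :: "'z measure"
  server :: "('q, 'z) server"
  machine :: "nat \<Rightarrow> ('q, 'z) machine"
  estimator :: "('q, 'z) view \<Rightarrow> vec measure"

definition private_fed_algorithm ::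
  "real \<Rightarrow> nat \<Rightarrow> nat \<Rightarrow> nat \<Rightarrow> ('q, 'z) fed_algorithm \<Rightarrow> bool" where
  "private_fed_algorithm \<epsilon> m n d P \<longleftrightarrow>
     is_server (server_msgs P) (machine_msgs P) {..<m} (rounds P) (server P) \<and>
     (\<forall>i<m. is_machine (server_msgs P) (machine_msgs P) n d (rounds P) (machine P i) \<and>
            private_machine \<epsilon> (server_msgs P) (machine_msgs P) n d (rounds P) i (machine P i)) \<and>
     estimator P \<in> view_space (server_msgs P) (machine_msgs P) {..<m} (rounds P)
       \<rightarrow>\<^sub>M prob_algebra (vec_space d)"

text \<open>The law of the estimate, over the data and the randomness of the algorithm.\<close>

definition estimate_law ::
  "nat \<Rightarrow> nat \<Rightarrow> nat \<Rightarrow> vec \<Rightarrow> ('q, 'z) fed_algorithm \<Rightarrow> vec measure" where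
  "estimate_law m n d \<mu> P =
     data_law m n d \<mu> \<bind> (\<lambda>X.
       transcript (server_msgs P) (machine_msgs P) {..<m} (server P) (machine P) X (rounds P)
         \<bind> estimator P)"

definition risk :: "nat \<Rightarrow> nat \<Rightarrow> nat \<Rightarrow> vec \<Rightarrow> ('q, 'z) fed_algorithm \<Rightarrow> ennreal" where
  "risk m n d \<mu> P =
     (\<integral>\<^sup>+ v. ennreal ((L2_set (\<lambda>k. \<mu> k - v k) {..<d})\<^sup>2) \<partial>estimate_law m n d \<mu> P)"

end

theory Submission
  imports Defs
begin

text \<open>
  The \<open>N = m n\<close> data points act as users of a local randomizer. In round \<open>t\<close> a single
  machine uses one fresh data point \<open>x\<close>: the server names a coordinate \<open>k\<close>, and the reply is a bit
  whose bias is of order \<open>\<epsilon>\<close> and proportional to \<open>sin (x k)\<close>. Since the bit is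
  \<open>\<epsilon>\<close>-private and every data point is used once, the whole interaction is \<open>\<epsilon>\<close>-private against every server. The sine is bounded, and
  \<open>E sin (x k) = exp (- 1 / 2) sin (\<mu> k)\<close>, which determines \<open>\<mu> k\<close> in a Lipschitz way for
  \<open>\<bar>\<mu> k\<bar> \<le> 1\<close>.

  Without adaptivity the sparse problem would cost an extra logarithmic factor. The server therefore
  proceeds by elimination: each stage queries all surviving coordinates equally often, keeps the
  quarter with the largest empirical means, and doubles the number of queries per coordinate. As
  soon as only \<open>O(s)\<close> coordinates survive, it estimates those and sets the others to \<open>0\<close>.
  If \<open>N < 2 d\<close>, the zero estimator already attains the rate, as \<open>\<epsilon> \<le> \<epsilon>\<^sub>0\<close>.
\<close>

section \<open>Transcripts as iterated kernels\<close>

text \<open>No single constant works for all \<epsilon>: the right side tends to 0 as \<epsilon>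
  grows, while the sampling error of \<open>m * n\<close> Gaussian points does not depend on
  \<epsilon>. This is why the constant depends on \<open>\<epsilon>\<^sub>0\<close>.

  Two obstacles shape the proof: a transcript is a law on real-valued views built from interleaved
  kernels, and adaptive queries make the replies dependent. One-bit replies remove both. For fixed
  data the transcript law is a finite mixture indexed by bit sequences. Along a fixed bit sequence
  the queries are fixed too, and since each data point is used once, the data integrate out factor
  by factor. The law of a bit is affine in the sine, so what remains is a bandit with rewards 1 or
  -1 whose means are proportional to \<open>sin (\<mu> k)\<close>, and every expectation is a finite
  sum. Its noise is a martingale, of which only second moments are needed.\<close>

lemma emeasure_PiM_box:
  assumes "finite I" "\<And>i. i \<in> I \<Longrightarrow> prob_space (M i)" "\<And>i. i \<in> I \<Longrightarrow> A i \<in> sets (M i)"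
  shows "emeasure (PiM I M) (Pi\<^sub>E I A) = (\<Prod>i\<in>I. emeasure (M i) (A i))"
proof -
  \<comment> \<open>\<open>product_sigma_finite\<close> speaks of all indices, the assumptions only
    of those in \<open>I\<close>. Point masses elsewhere close the gap and leave
    \<open>PiM I M\<close> unchanged.\<close>
  define M' where "M' i = (if i \<in> I then M i else return (count_space UNIV) undefined)" for i
  have ps: "prob_space (M' i)" for i
    using assms(2) by (auto simp: M'_def prob_space_return)
  then interpret product_sigma_finite M'
    by (simp add: product_sigma_finite_def prob_space_imp_sigma_finite)
  have "PiM I M = PiM I M'"
    by (intro PiM_cong) (auto simp: M'_def)
  then show ?thesis
    using emeasure_PiM[of I A] assms by (simp add: M'_def)
qed

lemma PiM_eq_boxes:
  assumes "finite I" "\<And>i. i \<in> I \<Longrightarrow> prob_space (M i)" "sets P = sets (PiM I M)"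
    and "\<And>A. (\<And>i. i \<in> I \<Longrightarrow> A i \<in> sets (M i)) \<Longrightarrow>
      emeasure P (Pi\<^sub>E I A) = (\<Prod>i\<in>I. emeasure (M i) (A i))"
  shows "P = PiM I M"
proof -
  define M' where "M' i = (if i \<in> I then M i else return (count_space UNIV) undefined)" for i
  have ps: "prob_space (M' i)" for i
    using assms(2) by (auto simp: M'_def prob_space_return)
  then interpret product_sigma_finite M'
    by (simp add: product_sigma_finite_def prob_space_imp_sigma_finite)
  have eq: "PiM I M = PiM I M'"
    by (intro PiM_cong) (auto simp: M'_def)
  show ?thesis
    unfolding eq by (rule PiM_eqI) (use assms eq in \<open>auto simp: M'_def\<close>)
qed

text \<open>Machines answer independently within a round, so their joint reply is a product kernel.
  Boxes generate the product sigma-algebra and are stable under intersection, and the mass of a box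
  is a finite product of measurable functions.\<close>

lemma measurable_PiM_kernel:
  assumes "finite I" "\<And>i. i \<in> I \<Longrightarrow> K i \<in> M \<rightarrow>\<^sub>M prob_algebra (N i)"
  shows "(\<lambda>x. \<Pi>\<^sub>M i\<in>I. K i x) \<in> M \<rightarrow>\<^sub>M prob_algebra (PiM I N)"
proof (rule measurable_prob_algebra_generated[OF sets_PiM Int_stable_prod_algebra prod_algebra_sets_into_space])
  have K: "prob_space (K i x)" "sets (K i x) = sets (N i)" if "x \<in> space M" "i \<in> I" for i x
    using measurable_space[OF assms(2)] that by (auto simp: space_prob_algebra)
  show "prob_space (\<Pi>\<^sub>M i\<in>I. K i x)" "sets (\<Pi>\<^sub>M i\<in>I. K i x) = sets (PiM I N)" if "x \<in> space M" for x
    using K that by (auto intro!: prob_space_PiM sets_PiM_cong)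
  fix A assume "A \<in> prod_algebra I N"
  then obtain E where E: "A = Pi\<^sub>E I E" "\<And>i. i \<in> I \<Longrightarrow> E i \<in> sets (N i)"
    using assms(1) by (auto simp: prod_algebra_eq_finite)
  have "(\<lambda>x. \<Prod>i\<in>I. emeasure (K i x) (E i)) \<in> borel_measurable M"
    using E(2) measurable_prob_algebraD[OF assms(2)] by measurable
  also have "?this \<longleftrightarrow> (\<lambda>x. emeasure (\<Pi>\<^sub>M i\<in>I. K i x) A) \<in> borel_measurable M"
    unfolding E(1) by (intro measurable_cong emeasure_PiM_box[symmetric] assms(1)) (use K E(2) in auto)
  finally show "(\<lambda>x. emeasure (\<Pi>\<^sub>M i\<in>I. K i x) A) \<in> borel_measurable M" .
qed

text \<open>Meant for rounds in which one machine answers at random and all others send a constant: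
  integrals over the joint reply then reduce to integrals over a single law.\<close>

lemma PiM_single_random:
  assumes "finite I" "i0 \<in> I" "prob_space D" "sets D = sets N" "c \<in> space N"
  shows "(\<Pi>\<^sub>M i\<in>I. if i = i0 then D else return N c)
    = distr D (\<Pi>\<^sub>M i\<in>I. N) (\<lambda>y. \<lambda>i\<in>I. if i = i0 then y else c)"
proof (rule PiM_eq_boxes[symmetric])
  have [measurable]: "(\<lambda>y. \<lambda>i\<in>I. if i = i0 then y else c) \<in> D \<rightarrow>\<^sub>M (\<Pi>\<^sub>M i\<in>I. N)"
  proof (intro measurable_restrict)
    show "(\<lambda>y. if i = i0 then y else c) \<in> D \<rightarrow>\<^sub>M N" for i
      using assms(5) measurable_ident_sets[OF assms(4)] by (cases "i = i0") auto
  qed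
  show "sets (distr D (\<Pi>\<^sub>M i\<in>I. N) (\<lambda>y. \<lambda>i\<in>I. if i = i0 then y else c)) =
    sets (\<Pi>\<^sub>M i\<in>I. if i = i0 then D else return N c)"
    by (simp, intro sets_PiM_cong) (simp_all add: assms(4))
  fix A assume A: "\<And>i. i \<in> I \<Longrightarrow> A i \<in> sets (if i = i0 then D else return N c)"
  then have AN: "A i \<in> sets N" if "i \<in> I" for i
    using A[OF that] by (simp add: assms(4) split: if_splits)
  have "emeasure (distr D (\<Pi>\<^sub>M i\<in>I. N) (\<lambda>y. \<lambda>i\<in>I. if i = i0 then y else c)) (Pi\<^sub>E I A)
    = emeasure D ((\<lambda>y. \<lambda>i\<in>I. if i = i0 then y else c) -` Pi\<^sub>E I A \<inter> space D)"
    using AN by (intro emeasure_distr) (auto intro!: sets_PiM_I_finite assms(1))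
  also have "(\<lambda>y. \<lambda>i\<in>I. if i = i0 then y else c) -` Pi\<^sub>E I A \<inter> space D =
     (if \<forall>i\<in>I - {i0}. c \<in> A i then A i0 else {})"
    using assms(2) sets.sets_into_space[OF AN[OF assms(2)]] sets_eq_imp_space_eq[OF assms(4)]
    by (fastforce simp: PiE_iff split: if_splits)
  also have "emeasure D \<dots> = (\<Prod>i\<in>I. emeasure (if i = i0 then D else return N c) (A i))"
  proof -
    have "(\<Prod>i\<in>I - {i0}. emeasure (if i = i0 then D else return N c) (A i))
      = (\<Prod>i\<in>I - {i0}. indicator (A i) c)"
      using AN by (intro prod.cong) auto
    also have "\<dots> = (if \<forall>i\<in>I - {i0}. c \<in> A i then 1 else 0)"
    proof (cases "\<forall>i\<in>I - {i0}. c \<in> A i")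
      case False
      then have "\<exists>i\<in>I - {i0}. indicator (A i) c = (0 :: ennreal)"
        by (simp add: indicator_eq_0_iff)
      then have "(\<Prod>i\<in>I - {i0}. indicator (A i) c) = (0 :: ennreal)"
        using assms(1) by (intro prod_zero) auto
      then show ?thesis
        by (simp only: False if_False)
    qed (auto intro!: prod.neutral)
    finally show ?thesis
      by (subst prod.remove[OF assms(1,2)]) auto
  qed
  finally show "emeasure (distr D (\<Pi>\<^sub>M i\<in>I. N) (\<lambda>y. \<lambda>i\<in>I. if i = i0 then y else c)) (Pi\<^sub>E I A)
    = (\<Prod>i\<in>I. emeasure (if i = i0 then D else return N c) (A i))" .
next
  show "prob_space (if i = i0 then D else return N c)" if "i \<in> I" for i
    using assms(3,5) by (simp add: prob_space_return)
qed (rule assms(1))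


section \<open>One round of interaction as a composition of kernels\<close>

definition next_view ::
  "nat set \<Rightarrow> nat \<Rightarrow> ('q, 'z) view \<Rightarrow> (nat \<Rightarrow> 'q) \<Rightarrow> (nat \<Rightarrow> 'z) \<Rightarrow> ('q, 'z) view" where
  "next_view I t v q z =
     (\<lambda>i\<in>I. (fst v i)(t := q i), \<lambda>i\<in>I. (snd v i)(t := z i))"

definition replies ::
  "nat set \<Rightarrow> (nat \<Rightarrow> ('q, 'z) machine) \<Rightarrow> (nat \<Rightarrow> dataset) \<Rightarrow> nat \<Rightarrow> ('q, 'z) view \<Rightarrow>
     (nat \<Rightarrow> 'q) \<Rightarrow> (nat \<Rightarrow> 'z) measure" where
  "replies I W X t v q = (\<Pi>\<^sub>M i\<in>I. W i t (X i, (fst v i)(t := q i), snd v i))"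

lemma measurable_append_round:
  assumes "\<And>i. i \<in> I \<Longrightarrow> (\<lambda>x. f x i) \<in> M \<rightarrow>\<^sub>M (\<Pi>\<^sub>M k\<in>{..<t}. N)"
    and "\<And>i. i \<in> I \<Longrightarrow> (\<lambda>x. g x i) \<in> M \<rightarrow>\<^sub>M N" and "i \<in> I"
  shows "(\<lambda>x. (f x i)(t := g x i)) \<in> M \<rightarrow>\<^sub>M (\<Pi>\<^sub>M k\<in>{..<Suc t}. N)"
  using measurable_fun_upd[OF _ assms(1)[OF assms(3)] assms(2)[OF assms(3)], of "{..<Suc t}" t]
  by (simp add: lessThan_Suc)

text \<open>Serves two purposes: with \<open>I = {i}\<close> and an arbitrary server it gives
  privacy, with \<open>I = {..<m}\<close> and the server of the protocol it gives the risk.\<close>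

locale interaction =
  fixes Q :: "'q measure" and Z :: "'z measure" and I :: "nat set" and n d T :: nat
    and S :: "('q, 'z) server" and W :: "nat \<Rightarrow> ('q, 'z) machine"
  assumes finite_I: "finite I"
    and server: "is_server Q Z I T S"
    and machines: "\<And>i. i \<in> I \<Longrightarrow> is_machine Q Z n d T (W i)"
begin

lemma measurable_next_view:
  "(\<lambda>((v, q), z). next_view I t v q z) \<in>
     (view_space Q Z I t \<Otimes>\<^sub>M PiM I (\<lambda>_. Q)) \<Otimes>\<^sub>M PiM I (\<lambda>_. Z) \<rightarrow>\<^sub>M view_space Q Z I (Suc t)"
  unfolding next_view_def view_space_def split_def
  by (intro measurable_Pair measurable_restrict measurable_append_round[where I = I]) measurable

lemma measurable_replies:
  assumes "t < T" "\<And>i. i \<in> I \<Longrightarrow> X i \<in> space (data_space n d)"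
  shows "(\<lambda>(v, q). replies I W X t v q) \<in>
     view_space Q Z I t \<Otimes>\<^sub>M PiM I (\<lambda>_. Q) \<rightarrow>\<^sub>M prob_algebra (PiM I (\<lambda>_. Z))"
  unfolding replies_def split_def
proof (intro measurable_PiM_kernel finite_I)
  fix i assume i: "i \<in> I"
  have W: "W i t \<in> data_space n d \<Otimes>\<^sub>M (\<Pi>\<^sub>M k\<in>{..<Suc t}. Q) \<Otimes>\<^sub>M (\<Pi>\<^sub>M k\<in>{..<t}. Z) \<rightarrow>\<^sub>M prob_algebra Z"
    using machines[OF i] assms(1) by (auto simp: is_machine_def)
  show "(\<lambda>x. W i t (X i, (fst (fst x) i)(t := snd x i), snd (fst x) i))
      \<in> view_space Q Z I t \<Otimes>\<^sub>M Pi\<^sub>M I (\<lambda>_. Q) \<rightarrow>\<^sub>M prob_algebra Z"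
    using i assms(2)
    by (intro measurable_compose[OF _ W] measurable_Pair measurable_const
         measurable_append_round[where I = I and i = i])
       (auto simp: view_space_def)
qed

lemma measurable_step:
  assumes "t < T" "\<And>i. i \<in> I \<Longrightarrow> X i \<in> space (data_space n d)"
  shows "(\<lambda>v. S t v \<bind> (\<lambda>q. replies I W X t v q \<bind>
     (\<lambda>z. return (view_space Q Z I (Suc t)) (next_view I t v q z))))
     \<in> view_space Q Z I t \<rightarrow>\<^sub>M prob_algebra (view_space Q Z I (Suc t))" (is "?step \<in> _")
    and "(\<lambda>(v, q). replies I W X t v q \<bind>
     (\<lambda>z. return (view_space Q Z I (Suc t)) (next_view I t v q z)))
     \<in> view_space Q Z I t \<Otimes>\<^sub>M PiM I (\<lambda>_. Q) \<rightarrow>\<^sub>M prob_algebra (view_space Q Z I (Suc t))" (is ?B)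
proof -
  have r: "(\<lambda>((v, q), z). return (view_space Q Z I (Suc t)) (next_view I t v q z))
    \<in> (view_space Q Z I t \<Otimes>\<^sub>M PiM I (\<lambda>_. Q)) \<Otimes>\<^sub>M PiM I (\<lambda>_. Z)
      \<rightarrow>\<^sub>M prob_algebra (view_space Q Z I (Suc t))"
    using measurable_compose[OF measurable_next_view measurable_return_prob_space]
    by (simp add: split_def)
  show B: ?B
    unfolding split_def
    by (rule measurable_bind_prob_space2[where N = "PiM I (\<lambda>_. Z)"])
       (use measurable_replies[OF assms] r in \<open>simp_all add: split_def\<close>)
  have "S t \<in> view_space Q Z I t \<rightarrow>\<^sub>M prob_algebra (PiM I (\<lambda>_. Q))"
    using server assms(1) by (simp add: is_server_def)
  then show "?step \<in> view_space Q Z I t \<rightarrow>\<^sub>M prob_algebra (view_space Q Z I (Suc t))"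
    by (rule measurable_bind_prob_space2) (rule B)
qed

lemma transcript_Suc:
  "transcript Q Z I S W X (Suc t) = transcript Q Z I S W X t \<bind>
     (\<lambda>v. S t v \<bind> (\<lambda>q. replies I W X t v q \<bind>
       (\<lambda>z. return (view_space Q Z I (Suc t)) (next_view I t v q z))))"
proof -
  have "(\<Pi>\<^sub>M i\<in>I. W i t (X i, (\<lambda>i\<in>I. (a i)(t := q i)) i, b i))
     = (\<Pi>\<^sub>M i\<in>I. W i t (X i, (a i)(t := q i), b i))" for a q b
    by (intro PiM_cong) auto
  then show ?thesis
    by (simp add: split_def Let_def replies_def next_view_def)
qed

lemma transcript_in_space:
  assumes "t \<le> T" "\<And>i. i \<in> I \<Longrightarrow> X i \<in> space (data_space n d)"
  shows "transcript Q Z I S W X t \<in> space (prob_algebra (view_space Q Z I t))"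
  using assms(1)
proof (induction t)
  case 0
  have "(\<lambda>i\<in>I. \<lambda>k. undefined, \<lambda>i\<in>I. \<lambda>k. undefined) \<in> space (view_space Q Z I 0)"
    by (auto simp: view_space_def space_pair_measure space_PiM)
  then show ?case
    by (simp add: space_prob_algebra prob_space_return)
next
  case (Suc t)
  then show ?case
    unfolding transcript_Suc
    using sets_bind'[OF _ measurable_step(1)] prob_space_bind'[OF _ measurable_step(1)] assms(2)
    by (simp add: space_prob_algebra)
qed


context
  fixes t :: nat and X :: "nat \<Rightarrow> dataset" and g :: "('q, 'z) view \<Rightarrow> ennreal"
  assumes t: "t < T" and X: "\<And>i. i \<in> I \<Longrightarrow> X i \<in> space (data_space n d)"
    and g: "g \<in> borel_measurable (view_space Q Z I (Suc t))"
begin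

lemma nn_integral_reply:
  assumes v: "v \<in> space (view_space Q Z I t)" and q: "q \<in> space (PiM I (\<lambda>_. Q))"
  shows "(\<integral>\<^sup>+u. g u \<partial>(replies I W X t v q \<bind>
        (\<lambda>z. return (view_space Q Z I (Suc t)) (next_view I t v q z))))
      = (\<integral>\<^sup>+z. g (next_view I t v q z) \<partial>replies I W X t v q)"
proof -
  have pair_space: "(v, q) \<in> space (view_space Q Z I t \<Otimes>\<^sub>M PiM I (\<lambda>_. Q))"
    using v q by (simp add: space_pair_measure)
  have "replies I W X t v q \<in> space (prob_algebra (PiM I (\<lambda>_. Z)))"
    using measurable_space[OF measurable_replies[OF t X] pair_space] by simp
  then have sets_r: "sets (replies I W X t v q) = sets (PiM I (\<lambda>_. Z))"
    by (simp add: space_prob_algebra)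
  have nv: "next_view I t v q \<in> PiM I (\<lambda>_. Z) \<rightarrow>\<^sub>M view_space Q Z I (Suc t)"
    using measurable_compose[OF measurable_Pair1'[OF pair_space] measurable_next_view] by simp
  have nv': "next_view I t v q \<in> replies I W X t v q \<rightarrow>\<^sub>M view_space Q Z I (Suc t)"
    using nv by (simp add: measurable_cong_sets[OF sets_r refl])
  have "(\<integral>\<^sup>+u. g u \<partial>(replies I W X t v q \<bind>
      (\<lambda>z. return (view_space Q Z I (Suc t)) (next_view I t v q z))))
    = (\<integral>\<^sup>+z. \<integral>\<^sup>+u. g u \<partial>return (view_space Q Z I (Suc t)) (next_view I t v q z)
         \<partial>replies I W X t v q)"
    by (rule nn_integral_bind[OF g]) (rule measurable_compose[OF nv' return_measurable])
  also have "\<dots> = (\<integral>\<^sup>+z. g (next_view I t v q z) \<partial>replies I W X t v q)"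
    by (intro nn_integral_cong nn_integral_return g measurable_space[OF nv'])
  finally show ?thesis .
qed

lemma measurable_nn_integral_reply:
  assumes v: "v \<in> space (view_space Q Z I t)"
  shows "(\<lambda>q. \<integral>\<^sup>+z. g (next_view I t v q z) \<partial>replies I W X t v q)
    \<in> borel_measurable (PiM I (\<lambda>_. Q))"
proof -
  have "(\<lambda>q. replies I W X t v q \<bind>
      (\<lambda>z. return (view_space Q Z I (Suc t)) (next_view I t v q z)))
      \<in> PiM I (\<lambda>_. Q) \<rightarrow>\<^sub>M subprob_algebra (view_space Q Z I (Suc t))"
    using measurable_prob_algebraD[OF measurable_compose[OF measurable_Pair1'[OF v]
        measurable_step(2)[OF t X]]] by simp
  from measurable_compose[OF this nn_integral_measurable_subprob_algebra[OF g]]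
  show ?thesis
    by (subst measurable_cong[OF nn_integral_reply[symmetric, OF v]]) auto
qed

lemma nn_integral_round:
  assumes v: "v \<in> space (view_space Q Z I t)"
  shows "(\<integral>\<^sup>+u. g u \<partial>(S t v \<bind> (\<lambda>q. replies I W X t v q \<bind>
        (\<lambda>z. return (view_space Q Z I (Suc t)) (next_view I t v q z)))))
      = (\<integral>\<^sup>+q. \<integral>\<^sup>+z. g (next_view I t v q z) \<partial>replies I W X t v q \<partial>S t v)"
proof -
  have St: "S t \<in> view_space Q Z I t \<rightarrow>\<^sub>M prob_algebra (PiM I (\<lambda>_. Q))"
    using server t by (simp add: is_server_def)
  have "S t v \<in> space (prob_algebra (PiM I (\<lambda>_. Q)))"
    by (rule measurable_space[OF St v])
  then have sets_S: "sets (S t v) = sets (PiM I (\<lambda>_. Q))"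
    by (simp add: space_prob_algebra)
  have m: "(\<lambda>q. replies I W X t v q \<bind>
      (\<lambda>z. return (view_space Q Z I (Suc t)) (next_view I t v q z)))
      \<in> S t v \<rightarrow>\<^sub>M subprob_algebra (view_space Q Z I (Suc t))"
    using measurable_prob_algebraD[OF measurable_compose[OF measurable_Pair1'[OF v]
        measurable_step(2)[OF t X]]]
    by (simp add: measurable_cong_sets[OF sets_S refl])
  show ?thesis
    unfolding nn_integral_bind[OF g m]
    by (intro nn_integral_cong nn_integral_reply v) (simp add: sets_eq_imp_space_eq[OF sets_S])
qed

lemma measurable_nn_integral_round:
  "(\<lambda>v. \<integral>\<^sup>+q. \<integral>\<^sup>+z. g (next_view I t v q z) \<partial>replies I W X t v q \<partial>S t v)
    \<in> borel_measurable (view_space Q Z I t)"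
  using measurable_compose[OF measurable_prob_algebraD[OF measurable_step(1)[OF t X]]
      nn_integral_measurable_subprob_algebra[OF g]]
  by (subst measurable_cong[OF nn_integral_round[symmetric]]) auto

text \<open>The tower property for one round. The inner integral is again a measurable function of
  the view, so it can take the place of \<open>g\<close> in inductions over the rounds.\<close>

lemma nn_integral_transcript_Suc:
  "(\<integral>\<^sup>+v. g v \<partial>transcript Q Z I S W X (Suc t)) =
    (\<integral>\<^sup>+v. \<integral>\<^sup>+q. \<integral>\<^sup>+z. g (next_view I t v q z) \<partial>replies I W X t v q \<partial>S t v
       \<partial>transcript Q Z I S W X t)"
proof -
  have sets_tr: "sets (transcript Q Z I S W X t) = sets (view_space Q Z I t)"
    using transcript_in_space[of t X] t X by (simp add: space_prob_algebra)
  have m: "(\<lambda>v. S t v \<bind> (\<lambda>q. replies I W X t v q \<bind>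
        (\<lambda>z. return (view_space Q Z I (Suc t)) (next_view I t v q z))))
      \<in> transcript Q Z I S W X t \<rightarrow>\<^sub>M subprob_algebra (view_space Q Z I (Suc t))"
    using measurable_prob_algebraD[OF measurable_step(1)[OF t X]]
    by (simp add: measurable_cong_sets[OF sets_tr refl])
  show ?thesis
    unfolding transcript_Suc nn_integral_bind[OF g m]
    by (intro nn_integral_cong nn_integral_round) (simp add: sets_eq_imp_space_eq[OF sets_tr])
qed

end

end

section \<open>Randomized response to a Gaussian sample\<close>

lemma (in prob_space) integrable_bounded_by_1:
  fixes f :: "'a \<Rightarrow> real"
  assumes "f \<in> borel_measurable M" "\<And>x. \<bar>f x\<bar> \<le> 1"
  shows "integrable M f"
  by (rule integrable_const_bound[where B = 1]) (use assms in auto)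

lemma integrable_normal_sin_cos:
  "integrable (density lborel (normal_density \<mu> 1)) (\<lambda>x. sin x)"
  "integrable (density lborel (normal_density \<mu> 1)) (\<lambda>x. cos x)"
  by (rule prob_space.integrable_bounded_by_1, rule prob_space_normal_density; simp)+

text \<open>Real and imaginary part of the characteristic function at 1.\<close>

lemma std_normal_cos_sin:
  "(LINT x|std_normal_distribution. cos x) = exp (- 1 / 2)"
  "(LINT x|std_normal_distribution. sin x) = 0"
proof -
  interpret N: prob_space std_normal_distribution
    by (rule prob_space_normal_density) simp
  have int: "integrable std_normal_distribution (\<lambda>x. iexp x)"
    using N.integrable_iexp[of "\<lambda>x. complex_of_real x"] by simp
  have ch: "(CLINT x|std_normal_distribution. iexp x) = complex_of_real (exp (- 1 / 2))"
    using fun_cong[OF char_std_normal_distribution, of 1] by (simp add: char_def)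
  have "(LINT x|std_normal_distribution. Re (iexp x)) = Re (complex_of_real (exp (- 1 / 2)))"
    unfolding integral_Re[OF int] ch ..
  then show "(LINT x|std_normal_distribution. cos x) = exp (- 1 / 2)"
    by (simp add: Re_exp)
  have "(LINT x|std_normal_distribution. Im (iexp x)) = Im (complex_of_real (exp (- 1 / 2)))"
    unfolding integral_Im[OF int] ch ..
  then show "(LINT x|std_normal_distribution. sin x) = 0"
    by (simp add: Im_exp)
qed

lemma normal_eq_shifted_std_normal:
  "density lborel (normal_density \<mu> 1) = distr std_normal_distribution borel (\<lambda>x. \<mu> + x)"
proof -
  interpret N: prob_space std_normal_distribution
    by (rule prob_space_normal_density) simp
  have "distributed std_normal_distribution lborel (\<lambda>x. x) std_normal_density"
    by (simp add: distributed_def distr_id2)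
  from N.normal_density_affine[OF this, of 1 \<mu>]
  have "density lborel (normal_density \<mu> 1) = distr std_normal_distribution lborel (\<lambda>x. \<mu> + x)"
    by (simp add: distributed_def)
  also have "\<dots> = distr std_normal_distribution borel (\<lambda>x. \<mu> + x)"
    by (rule distr_cong) simp_all
  finally show ?thesis .
qed

lemma integral_sin_normal:
  "(LINT x|density lborel (normal_density \<mu> 1). sin x) = exp (- 1 / 2) * sin \<mu>"
proof -
  have "(LINT x|density lborel (normal_density \<mu> 1). sin x)
    = (LINT x|std_normal_distribution. sin (\<mu> + x))"
    by (subst normal_eq_shifted_std_normal, rule integral_distr) measurable
  also have "\<dots> = (LINT x|std_normal_distribution. sin \<mu> * cos x)
      + (LINT x|std_normal_distribution. cos \<mu> * sin x)"
    unfolding sin_add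
    by (intro Bochner_Integration.integral_add integrable_mult_right integrable_normal_sin_cos)
  also have "\<dots> = exp (- 1 / 2) * sin \<mu>"
    unfolding integral_mult_right_zero std_normal_cos_sin by (simp only: mult_zero_right add_0_right mult.commute)
  finally show ?thesis .
qed

section \<open>The private bit\<close>

definition score :: "bool \<Rightarrow> real" where
  "score b = (if b then 1 else - 1)"

text \<open>The law of a bit whose score has mean \<open>\<alpha> * u\<close>. It is affine in
  \<open>u\<close>, so averaging over a random \<open>u\<close> merely replaces \<open>u\<close> by
  its mean.\<close>

definition response_prob :: "real \<Rightarrow> real \<Rightarrow> bool \<Rightarrow> real" where
  "response_prob \<alpha> u b = (1 + score b * \<alpha> * u) / 2"

lemma response_prob_nonneg:
  assumes "\<bar>\<alpha>\<bar> \<le> 1" "\<bar>u\<bar> \<le> 1"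
  shows "0 \<le> response_prob \<alpha> u b"
proof -
  have "\<bar>\<alpha> * u\<bar> \<le> 1"
    using assms by (simp add: abs_mult mult_le_one)
  then show ?thesis
    by (auto simp: response_prob_def score_def abs_le_iff)
qed

lemma nn_integral_response_prob_gaussian:
  assumes "\<bar>\<alpha>\<bar> \<le> 1" "k < d"
  shows "(\<integral>\<^sup>+x. ennreal (response_prob \<alpha> (sin (x k)) b) \<partial>std_gaussian d \<mu>)
    = ennreal (response_prob \<alpha> (exp (- 1 / 2) * sin (\<mu> k)) b)"
proof -
  let ?N = "density lborel (normal_density (\<mu> k) 1)"
  interpret N: prob_space ?N
    by (rule prob_space_normal_density) simp
  have "(\<integral>\<^sup>+x. ennreal (response_prob \<alpha> (sin (x k)) b) \<partial>std_gaussian d \<mu>)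
    = (\<integral>\<^sup>+y. ennreal (response_prob \<alpha> (sin y) b) \<partial>distr (std_gaussian d \<mu>) ?N (\<lambda>x. x k))"
    using assms(2) by (subst nn_integral_distr) (auto simp: std_gaussian_def response_prob_def)
  also have "distr (std_gaussian d \<mu>) ?N (\<lambda>x. x k) = ?N"
    unfolding std_gaussian_def
    by (rule distr_PiM_component) (use assms(2) in \<open>auto intro: prob_space_normal_density\<close>)
  also have "(\<integral>\<^sup>+y. ennreal (response_prob \<alpha> (sin y) b) \<partial>?N)
    = ennreal (LINT y|?N. response_prob \<alpha> (sin y) b)"
  proof (rule nn_integral_eq_integral)
    show "AE y in ?N. 0 \<le> response_prob \<alpha> (sin y) b"
      by (intro AE_I2 response_prob_nonneg assms(1)) simp
  qed (simp add: response_prob_def integrable_normal_sin_cos)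
  also have "(LINT y|?N. response_prob \<alpha> (sin y) b)
    = response_prob \<alpha> (exp (- 1 / 2) * sin (\<mu> k)) b"
    using N.prob_space by (simp add: response_prob_def integral_sin_normal integrable_normal_sin_cos)
  finally show ?thesis .
qed

definition response :: "real \<Rightarrow> real \<Rightarrow> real measure" where
  "response \<alpha> u = distr (measure_pmf (bernoulli_pmf (response_prob \<alpha> u True))) borel of_bool"

lemma nn_integral_response:
  assumes "\<bar>\<alpha>\<bar> \<le> 1" "\<bar>u\<bar> \<le> 1" "f \<in> borel_measurable borel"
  shows "(\<integral>\<^sup>+y. f y \<partial>response \<alpha> u) = (\<Sum>b\<in>UNIV. ennreal (response_prob \<alpha> u b) * f (of_bool b))"
proof -
  have False_prob: "1 - response_prob \<alpha> u True = response_prob \<alpha> u False"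
    by (simp add: response_prob_def score_def field_simps)
  have nonneg: "0 \<le> response_prob \<alpha> u b" for b
    using assms by (intro response_prob_nonneg)
  then have "response_prob \<alpha> u True \<le> 1"
    using False_prob nonneg[of False] by linarith
  then show ?thesis
    unfolding response_def using nonneg[of True] assms(3)
    by (simp add: nn_integral_distr UNIV_bool False_prob mult.commute)
qed

lemma prob_space_response: "prob_space (response \<alpha> u)"
  unfolding response_def by (rule prob_space.prob_space_distr[OF prob_space_measure_pmf]) simp

lemma sets_response [simp]: "sets (response \<alpha> u) = sets borel"
  by (simp add: response_def)

lemma measurable_response:
  assumes "\<bar>\<alpha>\<bar> \<le> 1" "u \<in> borel_measurable M" "\<And>x. x \<in> space M \<Longrightarrow> \<bar>u x\<bar> \<le> 1"
  shows "(\<lambda>x. response \<alpha> (u x)) \<in> M \<rightarrow>\<^sub>M prob_algebra borel"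
proof (intro measurable_prob_algebraI measurable_subprob_algebra)
  fix A :: "real set" assume A: "A \<in> sets borel"
  have "emeasure (response \<alpha> (u x)) A
      = (\<Sum>b\<in>UNIV. ennreal (response_prob \<alpha> (u x) b) * indicator A (of_bool b))"
    if "x \<in> space M" for x
    using nn_integral_response[OF assms(1) assms(3)[OF that], of "indicator A"] A by simp
  moreover have "(\<lambda>x. \<Sum>b\<in>UNIV. ennreal (response_prob \<alpha> (u x) b) * indicator A (of_bool b))
      \<in> borel_measurable M"
    using assms(2) unfolding response_prob_def by measurable
  ultimately show "(\<lambda>x. emeasure (response \<alpha> (u x)) A) \<in> borel_measurable M"
    by (simp cong: measurable_cong)
qed (simp_all add: prob_space_response prob_space_imp_subprob_space)

section \<open>A sequential protocol with one data point per round\<close>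

text \<open>An untrusted server may send any real \<open>c\<close>. If \<open>c\<close> is not a
  coordinate, the value 0 turns the reply into a fair coin. The form of a finite sum makes
  measurability in \<open>c\<close> and \<open>x\<close> evident.\<close>

definition queried_sine :: "nat \<Rightarrow> vec \<Rightarrow> real \<Rightarrow> real" where
  "queried_sine d x c = (\<Sum>k<d. if c = real k then sin (x k) else 0)"

lemma queried_sine_of_nat: "k < d \<Longrightarrow> queried_sine d x (real k) = sin (x k)"
  by (simp add: queried_sine_def)

lemma abs_queried_sine_le_1: "\<bar>queried_sine d x c\<bar> \<le> 1"
proof (cases "\<exists>k<d. c = real k")
  case True
  then show ?thesis
    by (auto simp: queried_sine_of_nat)
next
  case False
  then have "queried_sine d x c = 0"
    unfolding queried_sine_def by (intro sum.neutral) auto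
  then show ?thesis
    by simp
qed

text \<open>Round \<open>k\<close> belongs to data point \<open>k mod n\<close> of machine
  \<open>k div n\<close>, and only the reply of that machine carries information.\<close>

definition decode :: "nat \<Rightarrow> nat \<Rightarrow> (nat \<Rightarrow> nat \<Rightarrow> real) \<Rightarrow> bool list" where
  "decode n t b = map (\<lambda>k. 0 < b (k div n) k) [0..<t]"

lemma measurable_bool_list_map:
  assumes "\<And>k. k \<in> set ks \<Longrightarrow> (\<lambda>x. p k x) \<in> M \<rightarrow>\<^sub>M count_space (UNIV :: bool set)"
  shows "(\<lambda>x. map (\<lambda>k. p k x) ks) \<in> M \<rightarrow>\<^sub>M count_space UNIV"
  using assms
proof (induction ks)
  case (Cons k ks)
  have "(\<lambda>x. (p k x, map (\<lambda>k. p k x) ks)) \<in> M \<rightarrow>\<^sub>M count_space UNIV \<Otimes>\<^sub>M count_space UNIV"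
    using Cons by (intro measurable_Pair) auto
  then have "(\<lambda>x. (p k x, map (\<lambda>k. p k x) ks)) \<in> M \<rightarrow>\<^sub>M count_space UNIV"
    by (simp add: pair_measure_countable)
  from measurable_compose[OF this, of "\<lambda>(b, bs). b # bs" "count_space UNIV"] show ?case
    by simp
qed simp

lemma measurable_PiM_component2:
  assumes "i \<in> I" "j \<in> J"
  shows "(\<lambda>x. x i j) \<in> (\<Pi>\<^sub>M i\<in>I. PiM J N) \<rightarrow>\<^sub>M N j"
  by (rule measurable_compose[where g = "\<lambda>y. y j" and N = "PiM J N"])
     (rule measurable_component_singleton, rule assms)+

lemma measurable_decode:
  assumes "t \<le> m * n"
  shows "(\<lambda>v :: ('q :: topological_space, real) view. decode n t (snd v))
    \<in> view_space borel borel {..<m} t \<rightarrow>\<^sub>M count_space UNIV"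
  unfolding decode_def
proof (rule measurable_bool_list_map)
  fix k assume "k \<in> set [0..<t]"
  then have k: "k < t" by simp
  then have i: "k div n < m"
    using assms by (simp add: less_mult_imp_div_less)
  have "(\<lambda>v :: ('q, real) view. snd v (k div n) k) \<in> borel_measurable (view_space borel borel {..<m} t)"
    using i k unfolding view_space_def
    by (intro measurable_compose[OF measurable_snd] measurable_PiM_component2) auto
  then show "(\<lambda>v :: ('q, real) view. 0 < snd v (k div n) k) \<in> view_space borel borel {..<m} t \<rightarrow>\<^sub>M count_space UNIV"
    unfolding pred_def by (rule borel_measurable_less[OF borel_measurable_const])
qed

text \<open>The query rule and the estimator are arbitrary functions of the bits, so that privacy
  and the risk formula are proved once for the elimination scheme and the zero estimator
  alike.\<close>

locale sequential_protocol =
  fixes m n d :: nat and \<alpha> :: real and qry :: "bool list \<Rightarrow> nat" and est :: "bool list \<Rightarrow> vec"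
  assumes \<alpha>: "\<bar>\<alpha>\<bar> \<le> 1"
    and qry: "qry h < d"
    and est: "est h \<in> space (vec_space d)"
begin

definition query_server :: "(real, real) server" where
  "query_server t v =
     return (\<Pi>\<^sub>M i\<in>{..<m}. borel) (\<lambda>i\<in>{..<m}. real (qry (decode n t (snd v))))"

text \<open>The schedule is fixed in advance, so no server can make a machine read a data point
  twice.\<close>

definition response_machine :: "nat \<Rightarrow> (real, real) machine" where
  "response_machine i t = (\<lambda>(x, a, b).
     if t div n = i then response \<alpha> (queried_sine d (x (t mod n)) (a t)) else return borel 0)"

definition protocol :: "(real, real) fed_algorithm" where
  "protocol = \<lparr>rounds = m * n, server_msgs = borel, machine_msgs = borel,
     server = query_server, machine = response_machine,
     estimator = (\<lambda>v. return (vec_space d) (est (decode n (m * n) (snd v))))\<rparr>"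

lemma is_server_query_server: "is_server borel borel {..<m} (m * n) query_server"
  unfolding is_server_def
proof (intro allI impI)
  fix t assume "t < m * n"
  have "(\<lambda>h. \<lambda>i\<in>{..<m}. real (qry h)) \<in> count_space UNIV \<rightarrow>\<^sub>M (\<Pi>\<^sub>M i\<in>{..<m}. borel)"
    by (simp add: space_PiM)
  then have "(\<lambda>v. \<lambda>i\<in>{..<m}. real (qry (decode n t (snd v))))
      \<in> view_space borel borel {..<m} t \<rightarrow>\<^sub>M (\<Pi>\<^sub>M i\<in>{..<m}. borel)"
    using \<open>t < m * n\<close>
    by (intro measurable_compose[OF measurable_decode, where g = "\<lambda>h. \<lambda>i\<in>{..<m}. real (qry h)"])
       simp_all
  then show "query_server t \<in> view_space borel borel {..<m} t \<rightarrow>\<^sub>M prob_algebra (\<Pi>\<^sub>M i\<in>{..<m}. borel)"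
    unfolding query_server_def[abs_def]
    by (rule measurable_compose[OF _ measurable_return_prob_space])
qed

lemma is_machine_response_machine: "is_machine borel borel n d (m * n) (response_machine i)"
  unfolding is_machine_def
proof (intro allI impI)
  fix t assume "t < m * n"
  then have n: "t mod n < n"
    by (cases n) auto
  let ?M = "data_space n d \<Otimes>\<^sub>M (\<Pi>\<^sub>M k\<in>{..<Suc t}. borel) \<Otimes>\<^sub>M (\<Pi>\<^sub>M k\<in>{..<t}. borel :: real measure)"
  have x: "(\<lambda>w. fst w (t mod n) k) \<in> borel_measurable ?M" if "k < d" for k
    using n that unfolding data_space_def vec_space_def
    by (intro measurable_compose[OF measurable_fst] measurable_PiM_component2) auto
  have a: "(\<lambda>w. fst (snd w) t) \<in> borel_measurable ?M"
    by (intro measurable_compose[OF measurable_snd] measurable_compose[OF measurable_fst]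
         measurable_component_singleton) auto
  have "(\<lambda>w. queried_sine d (fst w (t mod n)) (fst (snd w) t)) \<in> borel_measurable ?M"
    unfolding queried_sine_def
  proof (rule borel_measurable_sum)
    fix k assume "k \<in> {..<d}"
    then have [measurable]: "(\<lambda>w. fst w (t mod n) k) \<in> borel_measurable ?M"
      "(\<lambda>w. fst (snd w) t) \<in> borel_measurable ?M"
      using x a by simp_all
    show "(\<lambda>w. if fst (snd w) t = real k then sin (fst w (t mod n) k) else 0) \<in> borel_measurable ?M"
      by measurable
  qed
  then have "(\<lambda>w. response \<alpha> (queried_sine d (fst w (t mod n)) (fst (snd w) t)))
      \<in> ?M \<rightarrow>\<^sub>M prob_algebra borel"
    by (intro measurable_response \<alpha> abs_queried_sine_le_1)
  moreover have "(\<lambda>w. return borel 0) \<in> ?M \<rightarrow>\<^sub>M prob_algebra borel"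
    by (rule measurable_const) (simp add: space_prob_algebra prob_space_return)
  ultimately show "response_machine i t \<in> ?M \<rightarrow>\<^sub>M prob_algebra borel"
    by (simp add: response_machine_def split_def)
qed

text \<open>\<open>W\<close> is only required to agree with \<open>response_machine\<close> on
  \<open>I\<close>; this covers the constant family in the definition of privacy as well as the full
  network.\<close>

lemma nn_integral_replies:
  assumes "finite I" "i0 \<in> I" "t div n = i0" "\<And>i. i \<in> I \<Longrightarrow> W i = response_machine i"
    and h: "h \<in> borel_measurable (\<Pi>\<^sub>M i\<in>I. borel)"
  shows "(\<integral>\<^sup>+z. h z \<partial>replies I W X t v q) =
    (\<Sum>b\<in>UNIV. ennreal (response_prob \<alpha> (queried_sine d (X i0 (t mod n)) (q i0)) b) *
       h (\<lambda>i\<in>I. if i = i0 then of_bool b else 0))"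
proof -
  let ?D = "response \<alpha> (queried_sine d (X i0 (t mod n)) (q i0))"
  have m: "(\<lambda>y::real. \<lambda>i\<in>I. if i = i0 then y else 0) \<in> borel \<rightarrow>\<^sub>M (\<Pi>\<^sub>M i\<in>I. borel)"
    by (intro measurable_restrict) auto
  have "replies I W X t v q = (\<Pi>\<^sub>M i\<in>I. if i = i0 then ?D else return borel 0)"
    unfolding replies_def using assms(3,4)
    by (intro PiM_cong) (auto simp: response_machine_def)
  also have "\<dots> = distr ?D (\<Pi>\<^sub>M i\<in>I. borel) (\<lambda>y. \<lambda>i\<in>I. if i = i0 then y else 0)"
    using assms(1,2) by (intro PiM_single_random prob_space_response) auto
  also have "(\<integral>\<^sup>+z. h z \<partial>\<dots>) = (\<integral>\<^sup>+y. h (\<lambda>i\<in>I. if i = i0 then y else 0) \<partial>?D)"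
    using m by (intro nn_integral_distr) (simp_all add: h measurable_cong_sets[OF sets_response refl])
  also have "\<dots> = (\<Sum>b\<in>UNIV. ennreal (response_prob \<alpha> (queried_sine d (X i0 (t mod n)) (q i0)) b) *
       h (\<lambda>i\<in>I. if i = i0 then of_bool b else 0))"
    by (rule nn_integral_response[OF \<alpha> abs_queried_sine_le_1 measurable_compose[OF m h]])
  finally show ?thesis .
qed

section \<open>Privacy against every server\<close>

lemma response_prob_le:
  assumes "1 + \<bar>\<alpha>\<bar> \<le> exp \<epsilon> * (1 - \<bar>\<alpha>\<bar>)" "\<bar>u\<bar> \<le> 1" "\<bar>u'\<bar> \<le> 1"
  shows "response_prob \<alpha> u b \<le> exp \<epsilon> * response_prob \<alpha> u' b"
proof -
  \<comment> \<open>Every answer has probability between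
    \<open>(1 - \<bar>\<alpha>\<bar>) / 2\<close> and \<open>(1 + \<bar>\<alpha>\<bar>) / 2\<close>,
    and the hypothesis bounds the ratio of these extremes.\<close>
  have "\<bar>\<alpha> * w\<bar> \<le> \<bar>\<alpha>\<bar>" if "\<bar>w\<bar> \<le> 1" for w
    using that by (simp add: abs_mult mult_left_le)
  from this[OF assms(2)] this[OF assms(3)]
  have "1 + score b * \<alpha> * u \<le> 1 + \<bar>\<alpha>\<bar>" "1 - \<bar>\<alpha>\<bar> \<le> 1 + score b * \<alpha> * u'"
    by (auto simp: score_def abs_le_iff)
  then have "1 + score b * \<alpha> * u \<le> exp \<epsilon> * (1 + score b * \<alpha> * u')"
    using assms(1) by (smt (verit) exp_gt_zero mult_left_mono)
  then show ?thesis
    by (simp add: response_prob_def)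
qed

text \<open>Each data point enters the transcript in one round only, so only that round costs privacy.\<close>

lemma transcript_le:
  assumes priv: "1 + \<bar>\<alpha>\<bar> \<le> exp \<epsilon> * (1 - \<bar>\<alpha>\<bar>)" "0 \<le> \<epsilon>"
    and S: "is_server borel borel {i} (m * n) S"
    and x: "x \<in> space (data_space n d)" "x' \<in> space (data_space n d)"
    and j: "j < n" "\<And>l. l < n \<Longrightarrow> l \<noteq> j \<Longrightarrow> x l = x' l"
    and t: "t \<le> m * n"
    and g: "g \<in> borel_measurable (view_space borel borel {i} t)"
  shows "(\<integral>\<^sup>+v. g v \<partial>transcript borel borel {i} S (\<lambda>_. response_machine i) (\<lambda>_. x) t)
    \<le> ennreal (if i * n + j < t then exp \<epsilon> else 1) *
      (\<integral>\<^sup>+v. g v \<partial>transcript borel borel {i} S (\<lambda>_. response_machine i) (\<lambda>_. x') t)"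
  using t g
\<comment> \<open>The hypothesis is applied to the integral \<open>?F x\<close> over the new round,
  hence the arbitrary \<open>g\<close> instead of indicators of sets. First the past is changed from
  \<open>x\<close> to \<open>x'\<close>, then the kernel of the new round.\<close>
proof (induction t arbitrary: g)
  case 0
  then show ?case by simp
next
  case (Suc t)
  interpret interaction borel borel "{i}" n d "m * n" S "\<lambda>_. response_machine i"
    by standard (simp_all add: S is_machine_response_machine)
  let ?tr = "\<lambda>x. transcript borel borel {i} S (\<lambda>_. response_machine i) (\<lambda>_. x)"
  let ?R = "\<lambda>x. replies {i} (\<lambda>_. response_machine i) (\<lambda>_. x) t"
  let ?F = "\<lambda>x v. \<integral>\<^sup>+q. \<integral>\<^sup>+z. g (next_view {i} t v q z) \<partial>?R x v q \<partial>S t v"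
  have t: "t < m * n" using Suc.prems by simp
  have mod: "t mod n < n" using j(1) by simp
  have meas: "?F x \<in> borel_measurable (view_space borel borel {i} t)"
    by (rule measurable_nn_integral_round[OF t _ Suc.prems(2)]) (simp add: x)
  have int_Suc: "(\<integral>\<^sup>+v. g v \<partial>?tr y (Suc t)) = (\<integral>\<^sup>+v. ?F y v \<partial>?tr y t)"
    if "y \<in> space (data_space n d)" for y
    by (rule nn_integral_transcript_Suc[OF t _ Suc.prems(2)]) (simp add: that)
  have sp: "space (?tr x' t) = space (view_space borel borel {i} t)"
    using transcript_in_space[of t "\<lambda>_. x'"] t x
    by (auto simp: space_prob_algebra dest!: sets_eq_imp_space_eq)
  have "(\<integral>\<^sup>+v. g v \<partial>?tr x (Suc t)) = (\<integral>\<^sup>+v. ?F x v \<partial>?tr x t)"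
    by (rule int_Suc[OF x(1)])
  also have "\<dots> \<le> ennreal (if i * n + j < t then exp \<epsilon> else 1) * (\<integral>\<^sup>+v. ?F x v \<partial>?tr x' t)"
    using t by (intro Suc.IH meas) simp
  also have "\<dots> \<le> ennreal (if i * n + j < Suc t then exp \<epsilon> else 1) * (\<integral>\<^sup>+v. ?F x' v \<partial>?tr x' t)"
  proof (cases "t = i * n + j")
    case False
    \<comment> \<open>In such a round the machine is idle or reads a point on which \<open>x\<close>
      and \<open>x'\<close> agree, so the reply kernels coincide.\<close>
    have "\<not> (t div n = i \<and> t mod n = j)"
      using False by (metis div_mult_mod_eq)
    then have "?R x v q = ?R x' v q" for v q
      unfolding replies_def using j(2)[OF mod]
      by (intro PiM_cong) (auto simp: response_machine_def)
    then show ?thesis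
      using False by (simp add: less_Suc_eq)
  next
    case True
    have div: "t div n = i"
      using True j(1) by simp
    \<comment> \<open>This is the one round that reads point \<open>j\<close>; up to here the factor
      is still 1. The comparison holds for each message \<open>q\<close>, so it survives averaging
      over any law from which the server draws \<open>q\<close>.\<close>
    have "?F x v \<le> ennreal (exp \<epsilon>) * ?F x' v" if v: "v \<in> space (view_space borel borel {i} t)" for v
    proof -
      have St: "S t v \<in> space (prob_algebra (\<Pi>\<^sub>M i\<in>{i}. borel))"
        using S t v unfolding is_server_def by (auto intro: measurable_space)
      then have sets_S: "sets (S t v) = sets (\<Pi>\<^sub>M i\<in>{i}. borel)"
        by (simp add: space_prob_algebra)
      have le: "(\<integral>\<^sup>+z. g (next_view {i} t v q z) \<partial>?R x v q)
          \<le> ennreal (exp \<epsilon>) * (\<integral>\<^sup>+z. g (next_view {i} t v q z) \<partial>?R x' v q)"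
        if q: "q \<in> space (\<Pi>\<^sub>M i\<in>{i}. borel)" for q
      proof -
        have "(v, q) \<in> space (view_space borel borel {i} t \<Otimes>\<^sub>M PiM {i} (\<lambda>_. borel))"
          using v q by (simp add: space_pair_measure)
        from measurable_compose[OF measurable_Pair1'[OF this] measurable_next_view]
        have m: "(\<lambda>z. g (next_view {i} t v q z)) \<in> borel_measurable (\<Pi>\<^sub>M i\<in>{i}. borel)"
          using Suc.prems(2) by (intro measurable_compose[OF _ Suc.prems(2)]) simp
        have R: "(\<integral>\<^sup>+z. g (next_view {i} t v q z) \<partial>?R y v q) =
          (\<Sum>b\<in>UNIV. ennreal (response_prob \<alpha> (queried_sine d (y (t mod n)) (q i)) b) *
           g (next_view {i} t v q (\<lambda>k\<in>{i}. if k = i then of_bool b else 0)))" for y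
          by (rule nn_integral_replies[OF _ _ div _ m]) auto
        have "ennreal (response_prob \<alpha> (queried_sine d (x (t mod n)) (q i)) b) \<le>
           ennreal (exp \<epsilon>) * ennreal (response_prob \<alpha> (queried_sine d (x' (t mod n)) (q i)) b)" for b
          using response_prob_le[OF priv(1) abs_queried_sine_le_1 abs_queried_sine_le_1]
          by (simp add: ennreal_mult'[symmetric] ennreal_leI)
        then show ?thesis
          unfolding R sum_distrib_left mult.assoc[symmetric]
          by (intro sum_mono mult_right_mono) simp_all
      qed
      have meas_q: "(\<lambda>q. \<integral>\<^sup>+z. g (next_view {i} t v q z) \<partial>?R x' v q) \<in> borel_measurable (S t v)"
        unfolding measurable_cong_sets[OF sets_S refl]
        by (rule measurable_nn_integral_reply[OF t _ Suc.prems(2) v]) (simp add: x)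
      have "?F x v \<le> (\<integral>\<^sup>+q. ennreal (exp \<epsilon>) * (\<integral>\<^sup>+z. g (next_view {i} t v q z) \<partial>?R x' v q) \<partial>S t v)"
        by (intro nn_integral_mono le) (simp add: sets_eq_imp_space_eq[OF sets_S])
      also have "\<dots> = ennreal (exp \<epsilon>) * ?F x' v"
        by (rule nn_integral_cmult[OF meas_q])
      finally show ?thesis .
    qed
    then have "(\<integral>\<^sup>+v. ?F x v \<partial>?tr x' t) \<le> (\<integral>\<^sup>+v. ennreal (exp \<epsilon>) * ?F x' v \<partial>?tr x' t)"
      by (intro nn_integral_mono) (simp add: sp)
    also have "\<dots> = ennreal (exp \<epsilon>) * (\<integral>\<^sup>+v. ?F x' v \<partial>?tr x' t)"
    proof (rule nn_integral_cmult)
      have "sets (?tr x' t) = sets (view_space borel borel {i} t)"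
        using transcript_in_space[of t "\<lambda>_. x'"] t x by (simp add: space_prob_algebra)
      then show "?F x' \<in> borel_measurable (?tr x' t)"
        unfolding measurable_cong_sets[OF \<open>sets (?tr x' t) = _\<close> refl]
        by (intro measurable_nn_integral_round[OF t _ Suc.prems(2)]) (simp add: x)
    qed
    finally show ?thesis
      using True by simp
  qed
  also have "(\<integral>\<^sup>+v. ?F x' v \<partial>?tr x' t) = (\<integral>\<^sup>+v. g v \<partial>?tr x' (Suc t))"
    by (rule int_Suc[OF x(2), symmetric])
  finally show ?case .
qed

lemma private_response_machine:
  assumes "1 + \<bar>\<alpha>\<bar> \<le> exp \<epsilon> * (1 - \<bar>\<alpha>\<bar>)" "0 \<le> \<epsilon>"
  shows "private_machine \<epsilon> borel borel n d (m * n) i (response_machine i)"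
  unfolding private_machine_def
proof (intro allI ballI impI)
  fix S :: "(real, real) server" and x x' and A :: "(real, real) view set"
  assume S: "is_server borel borel {i} (m * n) S"
    and x: "x \<in> space (data_space n d)" "x' \<in> space (data_space n d)" and "neighbours n x x'"
    and A: "A \<in> sets (view_space borel borel {i} (m * n))"
  then obtain j where j: "j < n" "\<And>l. l < n \<Longrightarrow> l \<noteq> j \<Longrightarrow> x l = x' l"
    by (auto simp: neighbours_def)
  let ?tr = "\<lambda>x. transcript borel borel {i} S (\<lambda>_. response_machine i) (\<lambda>_. x) (m * n)"
  interpret interaction borel borel "{i}" n d "m * n" S "\<lambda>_. response_machine i"
    by standard (simp_all add: S is_machine_response_machine)
  have sets_tr: "sets (?tr y) = sets (view_space borel borel {i} (m * n))" if "y \<in> space (data_space n d)" for y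
    using transcript_in_space[of "m * n" "\<lambda>_. y"] that by (simp add: space_prob_algebra)
  have "emeasure (?tr x) A = (\<integral>\<^sup>+v. indicator A v \<partial>?tr x)"
    using A sets_tr[OF x(1)] by simp
  also have "\<dots> \<le> ennreal (if i * n + j < m * n then exp \<epsilon> else 1) * (\<integral>\<^sup>+v. indicator A v \<partial>?tr x')"
    using A by (intro transcript_le[OF assms S x j]) simp_all
  \<comment> \<open>For \<open>i \<ge> m\<close> the round of point \<open>j\<close> never comes and
    the factor is 1; there \<open>0 \<le> \<epsilon>\<close> is needed.\<close>
  also have "\<dots> \<le> ennreal (exp \<epsilon>) * (\<integral>\<^sup>+v. indicator A v \<partial>?tr x')"
    using assms(2) by (intro mult_right_mono ennreal_leI) auto
  also have "(\<integral>\<^sup>+v. indicator A v \<partial>?tr x') = emeasure (?tr x') A"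
    using A sets_tr[OF x(2)] by simp
  finally show "emeasure (?tr x) A \<le> ennreal (exp \<epsilon>) * emeasure (?tr x') A" .
qed

lemma measurable_estimate_kernel:
  "(\<lambda>v. return (vec_space d) (est (decode n (m * n) (snd v))))
    \<in> view_space borel borel {..<m} (m * n) \<rightarrow>\<^sub>M prob_algebra (vec_space d)"
proof -
  have "est \<in> count_space UNIV \<rightarrow>\<^sub>M vec_space d"
    using est by simp
  then show ?thesis
    by (intro measurable_compose[OF measurable_compose[OF measurable_decode[OF order.refl]]
          measurable_return_prob_space])
qed

lemma private_fed_algorithm_protocol:
  assumes "1 + \<bar>\<alpha>\<bar> \<le> exp \<epsilon> * (1 - \<bar>\<alpha>\<bar>)" "0 \<le> \<epsilon>"
  shows "private_fed_algorithm \<epsilon> m n d protocol"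
  unfolding private_fed_algorithm_def protocol_def
  using is_server_query_server is_machine_response_machine private_response_machine[OF assms]
    measurable_estimate_kernel
  by simp

end

section \<open>The risk as a finite sum over reply sequences\<close>

definition bits :: "nat \<Rightarrow> bool list set" where
  "bits t = {h. length h = t}"

lemma finite_bits [simp]: "finite (bits t)"
  using finite_lists_length_eq[of "UNIV :: bool set" t] by (simp add: bits_def)

lemma bits_0 [simp]: "bits 0 = {[]}"
  by (simp add: bits_def)

lemma sum_bits_Suc: "(\<Sum>h\<in>bits (Suc t). F h) = (\<Sum>h\<in>bits t. \<Sum>b\<in>UNIV. F (h @ [b]))"
proof -
  have "bits (Suc t) = (\<lambda>(h, b). h @ [b]) ` (bits t \<times> UNIV)"
    by (auto simp: bits_def image_iff length_Suc_conv_rev)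
  moreover have "inj_on (\<lambda>(h, b). h @ [b]) (bits t \<times> UNIV)"
    by (auto simp: inj_on_def)
  ultimately show ?thesis
    by (simp add: sum.reindex sum.cartesian_product split_def)
qed

text \<open>The chain rule: if \<open>w h\<close> is the law of the next bit after the history
  \<open>h\<close>, this is the probability of a whole reply sequence.\<close>

definition path_weight :: "(bool list \<Rightarrow> bool \<Rightarrow> real) \<Rightarrow> bool list \<Rightarrow> real" where
  "path_weight w h = (\<Prod>k<length h. w (take k h) (h ! k))"

lemma path_weight_Nil [simp]: "path_weight w [] = 1"
  by (simp add: path_weight_def)

lemma path_weight_snoc [simp]: "path_weight w (h @ [b]) = path_weight w h * w h b"
  by (simp add: path_weight_def nth_append)

lemma path_weight_nonneg: "(\<And>h b. 0 \<le> w h b) \<Longrightarrow> 0 \<le> path_weight w h"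
  by (simp add: path_weight_def prod_nonneg)

lemma prod_lessThan_mult:
  fixes f :: "nat \<Rightarrow> 'a :: comm_monoid_mult"
  shows "(\<Prod>k<m * n. f k) = (\<Prod>i<m. \<Prod>j<n. f (i * n + j))"
proof -
  have "(\<Prod>k\<in>{i * n..<i * n + n}. f k) = (\<Prod>j<n. f (i * n + j))" for i
    using prod.shift_bounds_nat_ivl[of f 0 "i * n" n]
    by (simp add: atLeast0LessThan add.commute)
  then show ?thesis
    by (simp add: prod.nat_group[symmetric])
qed

context sequential_protocol
begin

definition data_weight :: "(nat \<Rightarrow> dataset) \<Rightarrow> bool list \<Rightarrow> bool \<Rightarrow> real" where
  "data_weight X h = response_prob \<alpha> (sin (X (length h div n) (length h mod n) (qry h)))"

definition mean_weight :: "vec \<Rightarrow> bool list \<Rightarrow> bool \<Rightarrow> real" where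
  "mean_weight \<mu> h = response_prob \<alpha> (exp (- 1 / 2) * sin (\<mu> (qry h)))"

text \<open>Server and idle machines are deterministic, so the bits determine the entire view. The
  restrictions to existing machines and rounds are there because views are extensional.\<close>

definition bit_view :: "bool list \<Rightarrow> (real, real) view" where
  "bit_view h =
     (\<lambda>i\<in>{..<m}. \<lambda>k\<in>{..<length h}. real (qry (take k h)),
      \<lambda>i\<in>{..<m}. \<lambda>k\<in>{..<length h}. if k div n = i then of_bool (h ! k) else 0)"

lemma bit_view_in_space: "bit_view h \<in> space (view_space borel borel {..<m} (length h))"
  by (auto simp: bit_view_def view_space_def space_pair_measure space_PiM)

lemma decode_bit_view: "length h \<le> m * n \<Longrightarrow> decode n (length h) (snd (bit_view h)) = h"
  by (intro nth_equalityI) (auto simp: decode_def bit_view_def less_mult_imp_div_less)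

lemma next_view_bit_view:
  assumes "t = length h" "i0 = t div n"
  shows "next_view {..<m} t (bit_view h) (\<lambda>i\<in>{..<m}. real (qry h))
     (\<lambda>i\<in>{..<m}. if i = i0 then of_bool b else 0) = bit_view (h @ [b])"
  unfolding next_view_def bit_view_def using assms
  by (auto simp: fun_eq_iff nth_append less_Suc_eq)

text \<open>Given the data, only the bits are random, so the transcript is a finite mixture of point
  masses at the views \<open>bit_view h\<close>.\<close>

lemma nn_integral_transcript:
  assumes X: "\<And>i. i < m \<Longrightarrow> X i \<in> space (data_space n d)" and t: "t \<le> m * n"
    and g: "g \<in> borel_measurable (view_space borel borel {..<m} t)"
  shows "(\<integral>\<^sup>+v. g v \<partial>transcript borel borel {..<m} query_server response_machine X t)
    = (\<Sum>h\<in>bits t. ennreal (path_weight (data_weight X) h) * g (bit_view h))"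
  using t g
proof (induction t arbitrary: g)
  case 0
  have "bit_view [] = (\<lambda>i\<in>{..<m}. \<lambda>k. undefined, \<lambda>i\<in>{..<m}. \<lambda>k. undefined)"
    by (simp add: bit_view_def fun_eq_iff)
  then show ?case
    using bit_view_in_space[of "[]"] 0 by (simp add: nn_integral_return)
next
  case (Suc t)
  interpret interaction borel borel "{..<m}" n d "m * n" query_server response_machine
    by standard (simp_all add: is_server_query_server is_machine_response_machine)
  have t: "t < m * n" using Suc.prems by simp
  then have div: "t div n < m" by (simp add: less_mult_imp_div_less)
  have X': "i \<in> {..<m} \<Longrightarrow> X i \<in> space (data_space n d)" for i
    using X by simp
  let ?R = "replies {..<m} response_machine X t"
  let ?F = "\<lambda>v. \<integral>\<^sup>+q. \<integral>\<^sup>+z. g (next_view {..<m} t v q z) \<partial>?R v q \<partial>query_server t v"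
  have round: "?F (bit_view h)
      = (\<Sum>b\<in>UNIV. ennreal (data_weight X h b) * g (bit_view (h @ [b])))" if h: "length h = t" for h
  proof -
    have v: "bit_view h \<in> space (view_space borel borel {..<m} t)"
      using bit_view_in_space[of h] h by simp
    let ?q = "\<lambda>i\<in>{..<m}. real (qry h)"
    have q: "?q \<in> space (\<Pi>\<^sub>M i\<in>{..<m}. borel)"
      by (simp add: space_PiM)
    have "query_server t (bit_view h) = return (\<Pi>\<^sub>M i\<in>{..<m}. borel) ?q"
      using decode_bit_view[of h] h t by (simp add: query_server_def)
    then have "?F (bit_view h) = (\<integral>\<^sup>+z. g (next_view {..<m} t (bit_view h) ?q z) \<partial>?R (bit_view h) ?q)"
      using nn_integral_return[OF q measurable_nn_integral_reply[OF t X' Suc.prems(2) v]] by simp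
    also have "\<dots> = (\<Sum>b\<in>UNIV. ennreal (response_prob \<alpha>
          (queried_sine d (X (t div n) (t mod n)) (?q (t div n))) b) *
        g (next_view {..<m} t (bit_view h) ?q (\<lambda>i\<in>{..<m}. if i = t div n then of_bool b else 0)))"
    proof (rule nn_integral_replies)
      have "(bit_view h, ?q) \<in> space (view_space borel borel {..<m} t \<Otimes>\<^sub>M PiM {..<m} (\<lambda>_. borel))"
        using v q by (simp add: space_pair_measure)
      from measurable_compose[OF measurable_Pair1'[OF this] measurable_next_view]
      show "(\<lambda>z. g (next_view {..<m} t (bit_view h) ?q z)) \<in> borel_measurable (\<Pi>\<^sub>M i\<in>{..<m}. borel)"
        by (intro measurable_compose[OF _ Suc.prems(2)]) simp
    qed (use div in auto)
    also have "queried_sine d (X (t div n) (t mod n)) (?q (t div n))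
        = sin (X (t div n) (t mod n) (qry h))"
      using div qry by (simp add: queried_sine_of_nat)
    finally show ?thesis
      unfolding next_view_bit_view[OF h[symmetric] refl] by (simp add: data_weight_def h)
  qed
  have nonneg: "0 \<le> data_weight X h b" for h b
    unfolding data_weight_def by (intro response_prob_nonneg \<alpha>) simp
  have "(\<integral>\<^sup>+v. g v \<partial>transcript borel borel {..<m} query_server response_machine X (Suc t))
      = (\<integral>\<^sup>+v. ?F v \<partial>transcript borel borel {..<m} query_server response_machine X t)"
    by (rule nn_integral_transcript_Suc[OF t X' Suc.prems(2)])
  also have "\<dots> = (\<Sum>h\<in>bits t. ennreal (path_weight (data_weight X) h) * ?F (bit_view h))"
    using t by (intro Suc.IH measurable_nn_integral_round[OF t X' Suc.prems(2)]) simp_all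
  also have "\<dots> = (\<Sum>h\<in>bits t. \<Sum>b\<in>UNIV.
      ennreal (path_weight (data_weight X) (h @ [b])) * g (bit_view (h @ [b])))"
    using nonneg
    by (intro sum.cong refl)
       (simp add: bits_def round sum_distrib_left ennreal_mult path_weight_nonneg mult.assoc)
  also have "\<dots> = (\<Sum>h\<in>bits (Suc t). ennreal (path_weight (data_weight X) h) * g (bit_view h))"
    by (simp add: sum_bits_Suc)
  finally show ?case .
qed

lemma mean_weight_nonneg: "0 \<le> mean_weight \<mu> h b"
  unfolding mean_weight_def by (intro response_prob_nonneg \<alpha>) (simp add: abs_mult mult_le_one)

text \<open>Adaptivity disappears here: a fixed \<open>h\<close> fixes all queries, so the weight is
  a product in which every data point occurs in exactly one factor, and independence moves the
  integral inside the product.\<close>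

lemma nn_integral_path_weight:
  assumes "length h = m * n"
  shows "(\<integral>\<^sup>+X. ennreal (path_weight (data_weight X) h) \<partial>data_law m n d \<mu>)
    = ennreal (path_weight (mean_weight \<mu>) h)"
proof -
  let ?G = "std_gaussian d \<mu>"
  have G: "prob_space ?G"
    unfolding std_gaussian_def by (intro prob_space_PiM prob_space_normal_density) simp
  then interpret G: product_sigma_finite "\<lambda>j::nat. ?G"
    by (simp add: product_sigma_finite_def prob_space_imp_sigma_finite)
  have "prob_space (\<Pi>\<^sub>M j\<in>{..<n}. ?G)"
    by (intro prob_space_PiM G)
  then interpret D: product_sigma_finite "\<lambda>i::nat. \<Pi>\<^sub>M j\<in>{..<n}. ?G"
    by (simp add: product_sigma_finite_def prob_space_imp_sigma_finite)
  let ?w = "\<lambda>k x. response_prob \<alpha> (sin (x (qry (take k h)))) (h ! k)"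
  have meas: "(\<lambda>x. ennreal (?w k x)) \<in> borel_measurable ?G" for k
  proof -
    have [measurable]: "(\<lambda>x. x (qry (take k h))) \<in> borel_measurable ?G"
      using measurable_component_singleton[of "qry (take k h)" "{..<d}"
          "\<lambda>k. density lborel (normal_density (\<mu> k) 1)"] qry
      by (simp add: std_gaussian_def)
    show ?thesis
      unfolding response_prob_def by measurable
  qed
  have "(\<integral>\<^sup>+X. ennreal (path_weight (data_weight X) h) \<partial>data_law m n d \<mu>)
      = (\<integral>\<^sup>+X. (\<Prod>i<m. \<Prod>j<n. ennreal (?w (i * n + j) (X i j))) \<partial>data_law m n d \<mu>)"
  proof (intro nn_integral_cong)
    fix X
    have "path_weight (data_weight X) h = (\<Prod>k<m * n. ?w k (X (k div n) (k mod n)))"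
      unfolding path_weight_def assms using assms
      by (intro prod.cong) (auto simp: data_weight_def)
    also have "\<dots> = (\<Prod>i<m. \<Prod>j<n. ?w (i * n + j) (X i j))"
      unfolding prod_lessThan_mult by (intro prod.cong) auto
    finally show "ennreal (path_weight (data_weight X) h)
        = (\<Prod>i<m. \<Prod>j<n. ennreal (?w (i * n + j) (X i j)))"
      by (simp add: prod_ennreal response_prob_nonneg \<alpha> prod_nonneg)
  qed
  also have "\<dots> = (\<Prod>i<m. \<integral>\<^sup>+x. (\<Prod>j<n. ennreal (?w (i * n + j) (x j))) \<partial>(\<Pi>\<^sub>M j\<in>{..<n}. ?G))"
    unfolding data_law_def
  proof (rule D.product_nn_integral_prod)
    fix i
    have [measurable]: "(\<lambda>x. ennreal (?w (i * n + j) (x j))) \<in> borel_measurable (\<Pi>\<^sub>M j\<in>{..<n}. ?G)"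
      if "j \<in> {..<n}" for j
      by (rule measurable_compose[OF measurable_component_singleton[OF that] meas])
    show "(\<lambda>x. \<Prod>j<n. ennreal (?w (i * n + j) (x j))) \<in> borel_measurable (\<Pi>\<^sub>M j\<in>{..<n}. ?G)"
      by measurable
  qed simp
  also have "\<dots> = (\<Prod>i<m. \<Prod>j<n. \<integral>\<^sup>+x. ennreal (?w (i * n + j) x) \<partial>?G)"
    by (intro prod.cong refl G.product_nn_integral_prod meas) auto
  also have "\<dots> = (\<Prod>k<m * n. ennreal (mean_weight \<mu> (take k h) (h ! k)))"
    unfolding prod_lessThan_mult[symmetric, where f = "\<lambda>k. \<integral>\<^sup>+x. ennreal (?w k x) \<partial>?G"]
    by (simp add: nn_integral_response_prob_gaussian \<alpha> qry mean_weight_def)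
  also have "\<dots> = ennreal (path_weight (mean_weight \<mu>) h)"
    by (simp add: path_weight_def assms prod_ennreal mean_weight_nonneg)
  finally show ?thesis .
qed

lemma nn_integral_estimate:
  assumes X: "\<And>i. i < m \<Longrightarrow> X i \<in> space (data_space n d)"
    and f: "f \<in> borel_measurable (vec_space d)"
  shows "(\<integral>\<^sup>+v. f v \<partial>(transcript borel borel {..<m} query_server response_machine X (m * n) \<bind>
      (\<lambda>v. return (vec_space d) (est (decode n (m * n) (snd v))))))
    = (\<Sum>h\<in>bits (m * n). ennreal (path_weight (data_weight X) h) * f (est h))"
proof -
  interpret interaction borel borel "{..<m}" n d "m * n" query_server response_machine
    by standard (simp_all add: is_server_query_server is_machine_response_machine)
  let ?tr = "transcript borel borel {..<m} query_server response_machine X (m * n)"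
  let ?e = "\<lambda>v :: (real, real) view. est (decode n (m * n) (snd v))"
  have sets_tr: "sets ?tr = sets (view_space borel borel {..<m} (m * n))"
    using transcript_in_space[of "m * n" X] X by (simp add: space_prob_algebra)
  have "(\<integral>\<^sup>+v. f v \<partial>(?tr \<bind> (\<lambda>v. return (vec_space d) (?e v))))
      = (\<integral>\<^sup>+v. \<integral>\<^sup>+u. f u \<partial>return (vec_space d) (?e v) \<partial>?tr)"
  proof (rule nn_integral_bind[OF f])
    show "(\<lambda>v. return (vec_space d) (?e v)) \<in> ?tr \<rightarrow>\<^sub>M subprob_algebra (vec_space d)"
      unfolding measurable_cong_sets[OF sets_tr refl]
      by (rule measurable_prob_algebraD[OF measurable_estimate_kernel])
  qed
  also have "\<dots> = (\<integral>\<^sup>+v. f (?e v) \<partial>?tr)"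
    by (intro nn_integral_cong nn_integral_return est f)
  also have "\<dots> = (\<Sum>h\<in>bits (m * n). ennreal (path_weight (data_weight X) h) * f (?e (bit_view h)))"
  proof (rule nn_integral_transcript[OF X])
    show "(\<lambda>v. f (?e v)) \<in> borel_measurable (view_space borel borel {..<m} (m * n))"
      using est by (intro measurable_compose[OF measurable_decode[OF order.refl],
            where g = "\<lambda>h. f (est h)"]) simp
  qed simp_all
  also have "\<dots> = (\<Sum>h\<in>bits (m * n). ennreal (path_weight (data_weight X) h) * f (est h))"
    using decode_bit_view by (intro sum.cong refl) (metis (mono_tags) bits_def mem_Collect_eq order.refl)
  finally show ?thesis .
qed

lemma risk_protocol:
  "risk m n d \<mu> protocol = ennreal (\<Sum>h\<in>bits (m * n).
     path_weight (mean_weight \<mu>) h * (\<Sum>k<d. (\<mu> k - est h k)\<^sup>2))"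
proof -
  let ?D = "data_law m n d \<mu>"
  let ?tr = "transcript borel borel {..<m} query_server response_machine"
  let ?K = "\<lambda>X. ?tr X (m * n) \<bind> (\<lambda>v. return (vec_space d) (est (decode n (m * n) (snd v))))"
  let ?loss = "\<lambda>v. ennreal ((L2_set (\<lambda>k. \<mu> k - v k) {..<d})\<^sup>2)"
  interpret interaction borel borel "{..<m}" n d "m * n" query_server response_machine
    by standard (simp_all add: is_server_query_server is_machine_response_machine)
  have loss: "?loss \<in> borel_measurable (vec_space d)"
    unfolding L2_set_def vec_space_def by measurable
  have sets_G: "sets (std_gaussian d \<mu>) = sets (vec_space d)"
    unfolding std_gaussian_def vec_space_def by (intro sets_PiM_cong) auto
  have sets_D: "sets ?D = sets (\<Pi>\<^sub>M i\<in>{..<m}. data_space n d)"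
    unfolding data_law_def data_space_def by (intro sets_PiM_cong sets_G refl)
  have X: "X i \<in> space (data_space n d)" if "X \<in> space ?D" "i < m" for X i
    using that unfolding sets_eq_imp_space_eq[OF sets_D] by (auto simp: space_PiM)
  have weight: "(\<lambda>X. ennreal (path_weight (data_weight X) h)) \<in> borel_measurable ?D"
    if h: "h \<in> bits (m * n)" for h
  proof -
    have [measurable]: "(\<lambda>X. X (k div n) (k mod n) (qry (take k h))) \<in> borel_measurable ?D"
      if "k < m * n" for k
    proof -
      have "k div n < m" "k mod n < n"
        using that by (auto simp: less_mult_imp_div_less intro!: mod_less_divisor gr0I)
      then show ?thesis
        unfolding measurable_cong_sets[OF sets_D refl]
        unfolding data_space_def vec_space_def using qry
        by (intro measurable_compose[OF measurable_PiM_component2, where g = "\<lambda>x. x (qry (take k h))"]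
              measurable_component_singleton) auto
    qed
    have "(\<lambda>X. \<Prod>k<m * n. response_prob \<alpha> (sin (X (k div n) (k mod n) (qry (take k h)))) (h ! k))
        \<in> borel_measurable ?D"
      unfolding response_prob_def by measurable
    moreover have "path_weight (data_weight X) h =
        (\<Prod>k<m * n. response_prob \<alpha> (sin (X (k div n) (k mod n) (qry (take k h)))) (h ! k))" for X
      using h unfolding path_weight_def by (intro prod.cong) (auto simp: data_weight_def bits_def)
    ultimately show ?thesis
      by simp
  qed
  \<comment> \<open>Measurability in the data is read off the finite sum: the mass of a set is a
    finite combination of the measurable path weights.\<close>
  have K: "?K \<in> ?D \<rightarrow>\<^sub>M subprob_algebra (vec_space d)"
  proof (rule measurable_subprob_algebra)
    fix X assume "X \<in> space ?D"
    then have tr: "?tr X (m * n) \<in> space (prob_algebra (view_space borel borel {..<m} (m * n)))"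
      by (intro transcript_in_space X) auto
    show "subprob_space (?K X)" "sets (?K X) = sets (vec_space d)"
      using prob_space_bind'[OF tr measurable_estimate_kernel]
        sets_bind'[OF tr measurable_estimate_kernel]
      by (simp_all add: prob_space_imp_subprob_space)
  next
    fix A assume A: "A \<in> sets (vec_space d)"
    have "emeasure (?K X) A = (\<Sum>h\<in>bits (m * n). ennreal (path_weight (data_weight X) h) * indicator A (est h))"
      if "X \<in> space ?D" for X
    proof -
      have "?tr X (m * n) \<in> space (prob_algebra (view_space borel borel {..<m} (m * n)))"
        by (intro transcript_in_space X that) auto
      from sets_bind'[OF this measurable_estimate_kernel] A
      have "emeasure (?K X) A = (\<integral>\<^sup>+v. indicator A v \<partial>?K X)"
        by simp
      also have "\<dots> = (\<Sum>h\<in>bits (m * n). ennreal (path_weight (data_weight X) h) * indicator A (est h))"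
        using A X[OF that] by (intro nn_integral_estimate) simp_all
      finally show ?thesis .
    qed
    moreover have "(\<lambda>X. \<Sum>h\<in>bits (m * n). ennreal (path_weight (data_weight X) h) * indicator A (est h))
        \<in> borel_measurable ?D"
      using weight by (intro borel_measurable_sum borel_measurable_times_ennreal) simp_all
    ultimately show "(\<lambda>X. emeasure (?K X) A) \<in> borel_measurable ?D"
      by (simp cong: measurable_cong)
  qed
  have "risk m n d \<mu> protocol = (\<integral>\<^sup>+v. ?loss v \<partial>(?D \<bind> ?K))"
    by (simp add: risk_def estimate_law_def protocol_def)
  also have "\<dots> = (\<integral>\<^sup>+X. \<integral>\<^sup>+v. ?loss v \<partial>?K X \<partial>?D)"
    by (rule nn_integral_bind[OF loss K])
  also have "\<dots> = (\<integral>\<^sup>+X. (\<Sum>h\<in>bits (m * n). ennreal (path_weight (data_weight X) h) * ?loss (est h)) \<partial>?D)"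
    by (intro nn_integral_cong nn_integral_estimate X loss)
  also have "\<dots> = (\<Sum>h\<in>bits (m * n). (\<integral>\<^sup>+X. ennreal (path_weight (data_weight X) h) \<partial>?D) * ?loss (est h))"
    using weight by (simp add: nn_integral_sum nn_integral_multc)
  also have "\<dots> = (\<Sum>h\<in>bits (m * n). ennreal (path_weight (mean_weight \<mu>) h * (\<Sum>k<d. (\<mu> k - est h k)\<^sup>2)))"
    by (intro sum.cong refl)
       (simp add: bits_def nn_integral_path_weight L2_set_def sum_nonneg ennreal_mult
          path_weight_nonneg mean_weight_nonneg)
  also have "\<dots> = ennreal (\<Sum>h\<in>bits (m * n).
     path_weight (mean_weight \<mu>) h * (\<Sum>k<d. (\<mu> k - est h k)\<^sup>2))"
    by (intro sum_ennreal mult_nonneg_nonneg path_weight_nonneg mean_weight_nonneg sum_nonneg) simp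
  finally show ?thesis .
qed

end

section \<open>Elimination of coordinates\<close>

text \<open>What the protocol becomes once the data are integrated out: asking for \<open>k\<close>
  returns a score with mean \<open>\<kappa> * \<theta> k\<close>. It is applied with
  \<open>\<kappa> = \<alpha> * exp (- 1 / 2)\<close> and
  \<open>\<theta> k = sin (\<mu> k)\<close>.\<close>

locale bandit =
  fixes qry :: "bool list \<Rightarrow> nat" and \<kappa> :: real and \<theta> :: "nat \<Rightarrow> real"
  assumes abs_mean_le_1: "\<bar>\<kappa> * \<theta> k\<bar> \<le> 1"
begin

definition bit_prob :: "bool list \<Rightarrow> bool \<Rightarrow> real" where
  "bit_prob h b = (1 + score b * (\<kappa> * \<theta> (qry h))) / 2"

definition expect :: "nat \<Rightarrow> (bool list \<Rightarrow> real) \<Rightarrow> real" where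
  "expect t G = (\<Sum>h\<in>bits t. path_weight bit_prob h * G h)"

lemma bit_prob_nonneg: "0 \<le> bit_prob h b"
  using abs_mean_le_1[of "qry h"] by (auto simp: bit_prob_def score_def abs_le_iff)

lemma expect_Suc: "expect (Suc t) G = expect t (\<lambda>h. \<Sum>b\<in>UNIV. bit_prob h b * G (h @ [b]))"
  by (simp add: expect_def sum_bits_Suc sum_distrib_left mult.assoc)

lemma expect_mono: "(\<And>h. length h = t \<Longrightarrow> F h \<le> G h) \<Longrightarrow> expect t F \<le> expect t G"
  unfolding expect_def
  by (intro sum_mono mult_left_mono path_weight_nonneg bit_prob_nonneg) (simp add: bits_def)

lemma expect_cong: "(\<And>h. length h = t \<Longrightarrow> F h = G h) \<Longrightarrow> expect t F = expect t G"
  by (intro order.antisym expect_mono) simp_all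

lemma expect_add: "expect t (\<lambda>h. F h + G h) = expect t F + expect t G"
  by (simp add: expect_def distrib_left sum.distrib)

lemma expect_mult: "expect t (\<lambda>h. c * G h) = c * expect t G"
  by (simp add: expect_def sum_distrib_left mult.left_commute)

lemma expect_sum: "expect t (\<lambda>h. \<Sum>i\<in>I. G i h) = (\<Sum>i\<in>I. expect t (G i))"
  unfolding expect_def sum_distrib_left by (rule sum.swap)

lemma expect_const: "expect t (\<lambda>_. c) = c"
proof (induction t)
  case 0
  then show ?case by (simp add: expect_def)
next
  case (Suc t)
  have "(\<Sum>b\<in>UNIV. bit_prob h b * c) = c" for h
    by (simp add: bit_prob_def score_def UNIV_bool field_simps)
  then show ?case
    by (simp add: expect_Suc Suc)
qed

text \<open>\<open>J\<close> selects which rounds count. It sees the query but not the reply, so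
  each summand is centred given the past and the sum is a martingale.\<close>

definition deviation :: "(nat \<Rightarrow> nat \<Rightarrow> bool) \<Rightarrow> bool list \<Rightarrow> real" where
  "deviation J h = (\<Sum>t<length h. of_bool (J t (qry (take t h))) *
     (score (h ! t) - \<kappa> * \<theta> (qry (take t h))))"

lemma deviation_snoc:
  "deviation J (h @ [b]) = deviation J h +
     of_bool (J (length h) (qry h)) * (score b - \<kappa> * \<theta> (qry h))"
  by (simp add: deviation_def nth_append)

text \<open>The increments are conditionally centred given the past, so the cross terms vanish.\<close>

lemma expect_deviation_square:
  "expect t (\<lambda>h. (deviation J h)\<^sup>2) \<le> expect t (\<lambda>h. \<Sum>k<t. of_bool (J k (qry (take k h))))"
proof (induction t)
  case 0
  then show ?case by (simp add: expect_def deviation_def)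
next
  case (Suc t)
  have step: "(\<Sum>b\<in>UNIV. bit_prob h b * (deviation J (h @ [b]))\<^sup>2)
      \<le> (deviation J h)\<^sup>2 + of_bool (J (length h) (qry h))" for h
  proof -
    let ?p = "\<kappa> * \<theta> (qry h)" and ?M = "deviation J h" and ?I = "of_bool (J (length h) (qry h)) :: real"
    \<comment> \<open>Given the past, the score has mean \<open>?p\<close> and variance
      \<open>1 - ?p\<^sup>2\<close>.\<close>
    have "(\<Sum>b\<in>UNIV. bit_prob h b * (deviation J (h @ [b]))\<^sup>2) = ?M\<^sup>2 + ?I\<^sup>2 * (1 - ?p\<^sup>2)"
      unfolding deviation_snoc bit_prob_def score_def UNIV_bool
      by (simp add: field_simps power2_eq_square)
    also have "\<dots> \<le> ?M\<^sup>2 + ?I"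
      by simp
    finally show ?thesis .
  qed
  have "expect (Suc t) (\<lambda>h. (deviation J h)\<^sup>2)
      \<le> expect t (\<lambda>h. (deviation J h)\<^sup>2 + of_bool (J (length h) (qry h)))"
    unfolding expect_Suc by (intro expect_mono step)
  also have "\<dots> \<le> expect t (\<lambda>h. (\<Sum>k<t. of_bool (J k (qry (take k h)))) + of_bool (J (length h) (qry h)))"
    unfolding expect_add using Suc by simp
  also have "\<dots> = expect (Suc t) (\<lambda>h. \<Sum>k<Suc t. of_bool (J k (qry (take k h))))"
    unfolding expect_Suc
  proof (rule expect_cong)
    fix h :: "bool list" assume h: "length h = t"
    let ?c = "(\<Sum>k<t. of_bool (J k (qry (take k h)))) + of_bool (J (length h) (qry h)) :: real"
    have "(\<Sum>k<Suc t. of_bool (J k (qry (take k (h @ [b]))))) = ?c" for b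
      using h by simp
    then show "?c = (\<Sum>b\<in>UNIV. bit_prob h b * (\<Sum>k<Suc t. of_bool (J k (qry (take k (h @ [b]))))))"
      by (simp add: bit_prob_def score_def UNIV_bool field_simps)
  qed
  finally show ?case .
qed

end

section \<open>The schedule of the elimination stages\<close>

lemma sort_key_take_le:
  assumes "x \<in> set (take c (sort_key f xs))" "y \<in> set xs" "y \<notin> set (take c (sort_key f xs))"
  shows "f x \<le> f y"
proof -
  have "y \<in> set (take c (sort_key f xs)) \<union> set (drop c (sort_key f xs))"
    using assms(2) by (simp only: set_append[symmetric] append_take_drop_id set_sort)
  then have "y \<in> set (drop c (sort_key f xs))"
    using assms(3) by blast
  moreover have "sorted (map f (take c (sort_key f xs)) @ map f (drop c (sort_key f xs)))"
    unfolding map_append[symmetric] append_take_drop_id by (rule sorted_sort_key)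
  ultimately show ?thesis
    using assms(1) by (auto simp: sorted_append)
qed

lemma sum_lessThan_mult:
  fixes f :: "nat \<Rightarrow> 'a :: comm_monoid_add"
  shows "(\<Sum>k<m * n. f k) = (\<Sum>i<m. \<Sum>j<n. f (i * n + j))"
proof -
  have "(\<Sum>k\<in>{i * n..<i * n + n}. f k) = (\<Sum>j<n. f (i * n + j))" for i
    using sum.shift_bounds_nat_ivl[of f 0 "i * n" n]
    by (simp add: atLeast0LessThan add.commute)
  then show ?thesis
    by (simp add: sum.nat_group[symmetric])
qed

lemma sum_of_bool_nth:
  assumes "distinct xs"
  shows "(\<Sum>j<length xs. of_bool (xs ! j = x)) = (of_bool (x \<in> set xs) :: real)"
proof (cases "x \<in> set xs")
  case True
  then obtain i where "i < length xs" "xs ! i = x"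
    by (auto simp: in_set_conv_nth)
  then have "{j. j < length xs \<and> xs ! j = x} = {i}"
    using assms by (auto simp: nth_eq_iff_index_eq)
  then show ?thesis
    using True by (simp add: sum_of_bool_eq lessThan_def Collect_conj_eq[symmetric] Int_def)
qed (auto intro!: sum.neutral)

text \<open>\<open>K r\<close> counts the coordinates alive in stage \<open>r\<close>, and
  \<open>L r\<close> the queries that each of them receives there. Stages below \<open>R\<close>
  select, stage \<open>R\<close> estimates.\<close>

locale elimination =
  fixes d R :: nat and K L :: "nat \<Rightarrow> nat"
  assumes K_0: "K 0 = d"
    and K_Suc: "r < R \<Longrightarrow> K (Suc r) \<le> K r"
    and L_pos: "0 < L r"
    and d_pos: "0 < d"
begin

definition start :: "nat \<Rightarrow> nat" where
  "start r = (\<Sum>r'<r. K r' * L r')"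

text \<open>The queried list is an argument because \<open>active\<close> is itself defined from
  \<open>total\<close>. Each entry of \<open>ks\<close> owns a block of \<open>L r\<close>
  consecutive rounds, and only replies of stage \<open>r\<close> enter.\<close>

definition total :: "nat \<Rightarrow> nat list \<Rightarrow> bool list \<Rightarrow> nat \<Rightarrow> real" where
  "total r ks h k = (\<Sum>u<K r * L r. of_bool (ks ! (u div L r) = k) * score (h ! (start r + u)))"

primrec active :: "nat \<Rightarrow> bool list \<Rightarrow> nat list" where
  "active 0 h = [0..<d]"
| "active (Suc r) h =
     take (K (Suc r)) (sort_key (\<lambda>k. - \<bar>total r (active r h) h k\<bar>) (active r h))"

definition stage :: "nat \<Rightarrow> nat" where
  "stage t = (LEAST r. t < start (Suc r))"

text \<open>Data points left over after the last stage are asked for coordinate 0; the estimate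
  ignores these replies.\<close>

definition query :: "bool list \<Rightarrow> nat" where
  "query h = (let t = length h; r = stage t in
     if t < start (Suc R) then active r h ! ((t - start r) div L r) else 0)"

lemma start_Suc: "start (Suc r) = start r + K r * L r"
  by (simp add: start_def)

lemma start_mono: "r \<le> r' \<Longrightarrow> start r \<le> start r'"
  unfolding start_def by (intro sum_mono2) auto

lemma stage_eq:
  assumes "start r \<le> t" "t < start (Suc r)"
  shows "stage t = r"
  unfolding stage_def
proof (rule Least_equality)
  fix y assume "t < start (Suc y)"
  then show "r \<le> y"
    using assms(1) start_mono[of "Suc y" r] by (cases "r \<le> y") auto
qed (rule assms)

lemma active_props:
  assumes "r \<le> R"
  shows length_active: "length (active r h) = K r"
    and distinct_active: "distinct (active r h)"
    and active_less: "k \<in> set (active r h) \<Longrightarrow> k < d"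
proof -
  have "length (active r h) = K r \<and> distinct (active r h) \<and> set (active r h) \<subseteq> {..<d}"
    using assms
  proof (induction r)
    case (Suc r)
    then show ?case
      using K_Suc[of r] set_take_subset[of "K (Suc r)"] by (fastforce simp: distinct_sort)
  qed (auto simp: K_0)
  then show "length (active r h) = K r" "distinct (active r h)"
    "k \<in> set (active r h) \<Longrightarrow> k < d"
    by auto
qed

text \<open>Causality: the list of stage \<open>r\<close> depends only on replies before
  \<open>start r\<close>, so what the server computes during the stage agrees with what the full
  history gives.\<close>

lemma active_take: "start r \<le> t \<Longrightarrow> active r (take t h) = active r h"
proof (induction r)
  case (Suc r)
  have "total r ks (take t h) = total r ks h" for ks
    unfolding total_def using Suc.prems
    by (intro ext sum.cong refl) (simp add: start_Suc)
  then show ?case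
    using Suc by (simp add: start_Suc)
qed simp

lemma query_in_stage:
  assumes "r \<le> R" "u < K r * L r" "start r + u \<le> length h"
  shows "query (take (start r + u) h) = active r h ! (u div L r)"
proof -
  have "start r + u < start (Suc r)"
    using assms(2) by (simp add: start_Suc)
  moreover have "start (Suc r) \<le> start (Suc R)"
    using assms(1) by (intro start_mono) simp
  ultimately show ?thesis
    using assms(3) stage_eq[of r "start r + u"] active_take[of r "start r + u" h]
    by (simp add: query_def)
qed

lemma stage_props:
  assumes "t < start (Suc R)"
  shows "stage t \<le> R" "start (stage t) \<le> t" "t < start (Suc (stage t))"
proof -
  show "stage t \<le> R" "t < start (Suc (stage t))"
    unfolding stage_def using assms by (auto intro: Least_le LeastI)
  show "start (stage t) \<le> t"
  proof (cases "stage t")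
    case (Suc r)
    then show ?thesis
      using not_less_Least[of r "\<lambda>r. t < start (Suc r)"] by (simp add: stage_def)
  qed (simp add: start_def)
qed

lemma query_less: "query h < d"
proof (cases "length h < start (Suc R)")
  case True
  let ?r = "stage (length h)"
  note p = stage_props[OF True]
  have "(length h - start ?r) div L ?r < K ?r"
    using p(2,3) by (simp add: start_Suc less_mult_imp_div_less)
  then have "active ?r h ! ((length h - start ?r) div L ?r) \<in> set (active ?r h)"
    using length_active[OF p(1)] by simp
  then show ?thesis
    using True active_less[OF p(1)] by (simp add: query_def Let_def)
qed (simp add: query_def d_pos)

lemma active_Suc_subset: "set (active (Suc r) h) \<subseteq> set (active r h)"
  using set_take_subset by fastforce

lemma eliminated_stage:
  assumes "k < d" "k \<notin> set (active r h)"
  shows "\<exists>r'<r. k \<in> set (active r' h) \<and> k \<notin> set (active (Suc r') h)"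
  using assms(2)
proof (induction r)
  case (Suc r)
  then show ?case
    by (cases "k \<in> set (active r h)") (auto simp del: active.simps intro: less_SucI)
qed (use assms(1) in simp)

definition estimate :: "real \<Rightarrow> bool list \<Rightarrow> nat \<Rightarrow> real" where
  "estimate \<kappa> h k = (if k \<in> set (active R h)
     then total R (active R h) h k / (real (L R) * \<kappa>) else 0)"

end

section \<open>The expected error of elimination\<close>

locale elimination_bandit = elimination d R K L + bandit query \<kappa> \<theta>
  for d R K L \<kappa> \<theta> +
  fixes N s :: nat
  assumes budget: "start (Suc R) \<le> N"
    and sparse: "card {k\<in>{..<d}. \<theta> k \<noteq> 0} \<le> s"
    and K_large: "r < R \<Longrightarrow> s < K (Suc r)"
    and \<kappa>_nonzero: "\<kappa> \<noteq> 0"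
begin

definition noise :: "nat \<Rightarrow> nat \<Rightarrow> bool list \<Rightarrow> real" where
  "noise r k = deviation (\<lambda>t q. start r \<le> t \<and> t < start (Suc r) \<and> q = k)"

text \<open>The martingale bound sums over rounds, \<open>total\<close> over the slots of one stage.
  This translates between them; \<open>f = 1\<close> counts queries, and centred scores give the
  noise.\<close>

lemma sum_stage:
  assumes "r \<le> R" "length h = N"
  shows "(\<Sum>t<N. of_bool (start r \<le> t \<and> t < start (Suc r) \<and> query (take t h) = k) * f t)
    = (\<Sum>u<K r * L r. of_bool (active r h ! (u div L r) = k) * (f (start r + u) :: real))"
proof -
  have N: "start (Suc r) \<le> N"
    using start_mono[of "Suc r" "Suc R"] budget assms(1) by simp
  have "(\<Sum>t<N. of_bool (start r \<le> t \<and> t < start (Suc r) \<and> query (take t h) = k) * f t)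
      = (\<Sum>t\<in>{start r..<start (Suc r)}. of_bool (query (take t h) = k) * f t)"
    using N by (intro sum.mono_neutral_cong_right) auto
  also have "\<dots> = (\<Sum>u<K r * L r. of_bool (query (take (start r + u) h) = k) * f (start r + u))"
    using sum.shift_bounds_nat_ivl[of "\<lambda>t. of_bool (query (take t h) = k) * f t" 0 "start r" "K r * L r"]
    by (simp add: start_Suc atLeast0LessThan add.commute)
  also have "\<dots> = (\<Sum>u<K r * L r. of_bool (active r h ! (u div L r) = k) * f (start r + u))"
    using N assms by (intro sum.cong refl) (simp add: query_in_stage start_Suc)
  finally show ?thesis .
qed

lemma sum_stage_count:
  assumes "r \<le> R"
  shows "(\<Sum>u<K r * L r. of_bool (active r h ! (u div L r) = k))
    = real (L r) * of_bool (k \<in> set (active r h))"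
proof -
  have "(\<Sum>u<K r * L r. of_bool (active r h ! (u div L r) = k))
      = (\<Sum>j<K r. real (L r) * of_bool (active r h ! j = k))"
    unfolding sum_lessThan_mult using L_pos[of r] by simp
  also have "\<dots> = real (L r) * of_bool (k \<in> set (active r h))"
    using sum_of_bool_nth[OF distinct_active[OF assms], of h k] length_active[OF assms, of h]
    by (simp add: sum_distrib_left[symmetric])
  finally show ?thesis .
qed

lemma noise_eq:
  assumes "r \<le> R" "length h = N" "k \<in> set (active r h)"
  shows "total r (active r h) h k = noise r k h + real (L r) * (\<kappa> * \<theta> k)"
proof -
  have "noise r k h = (\<Sum>t<N. of_bool (start r \<le> t \<and> t < start (Suc r) \<and> query (take t h) = k) *
      (score (h ! t) - \<kappa> * \<theta> k))"
    unfolding noise_def deviation_def assms(2) by (intro sum.cong) auto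
  also have "\<dots> = (\<Sum>u<K r * L r. of_bool (active r h ! (u div L r) = k) *
      (score (h ! (start r + u)) - \<kappa> * \<theta> k))"
    by (rule sum_stage[OF assms(1,2)])
  also have "\<dots> = total r (active r h) h k - (\<Sum>u<K r * L r. of_bool (active r h ! (u div L r) = k)) * (\<kappa> * \<theta> k)"
    by (simp add: total_def right_diff_distrib sum_subtractf sum_distrib_right)
  finally show ?thesis
    unfolding sum_stage_count[OF assms(1)] using assms(3) by simp
qed

lemma expect_noise_square:
  assumes "r \<le> R"
  shows "expect N (\<lambda>h. (noise r k h)\<^sup>2) \<le> expect N (\<lambda>h. real (L r) * of_bool (k \<in> set (active r h)))"
proof -
  have "expect N (\<lambda>h. (noise r k h)\<^sup>2) \<le> expect N (\<lambda>h. \<Sum>t<N.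
      of_bool (start r \<le> t \<and> t < start (Suc r) \<and> query (take t h) = k))"
    unfolding noise_def by (rule expect_deviation_square)
  also have "\<dots> = expect N (\<lambda>h. real (L r) * of_bool (k \<in> set (active r h)))"
    using sum_stage[OF assms, of _ k "\<lambda>_. 1"] sum_stage_count[OF assms, of _ k]
    by (intro expect_cong) simp
  finally show ?thesis .
qed

lemma expect_noise_square_le:
  assumes "r \<le> R"
  shows "expect N (\<lambda>h. (noise r k h)\<^sup>2) \<le> real (L r)"
proof -
  have "expect N (\<lambda>h. real (L r) * of_bool (k \<in> set (active r h))) \<le> expect N (\<lambda>_. real (L r))"
    by (intro expect_mono) simp
  then show ?thesis
    using expect_noise_square[OF assms, of k] by (simp add: expect_const)
qed

text \<open>Which coordinates are active is random, but there are always exactly \<open>K r\<close>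
  of them. Summing over \<open>k\<close> before taking the expectation therefore gives the factor
  \<open>K r\<close> instead of \<open>d\<close>.\<close>

lemma expect_sum_noise_square_le:
  assumes "r \<le> R"
  shows "expect N (\<lambda>h. \<Sum>k<d. (noise r k h)\<^sup>2) \<le> real (K r) * real (L r)"
proof -
  have "expect N (\<lambda>h. \<Sum>k<d. (noise r k h)\<^sup>2)
      \<le> expect N (\<lambda>h. \<Sum>k<d. real (L r) * of_bool (k \<in> set (active r h)))"
    unfolding expect_sum by (intro sum_mono expect_noise_square assms)
  also have "\<dots> = expect N (\<lambda>_. real (K r) * real (L r))"
  proof (rule expect_cong)
    fix h
    have "(\<Sum>k<d. of_bool (k \<in> set (active r h))) = real (card (set (active r h)))"
      using active_less[OF assms, of _ h] by (subst sum_of_bool_eq) (auto intro!: arg_cong[where f = card])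
    then show "(\<Sum>k<d. real (L r) * of_bool (k \<in> set (active r h))) = real (K r) * real (L r)"
      using length_active[OF assms, of h] distinct_active[OF assms, of h]
      by (simp add: sum_distrib_left[symmetric] distinct_card mult.commute)
  qed
  finally show ?thesis
    by (simp add: expect_const)
qed

text \<open>
  If a coordinate is dropped, then its own noise is at least half its signal, or this holds for the
  noise of each of the at least \<open>K (Suc r) - s\<close> null coordinates that are kept. Bounding the number
  of the latter by Markov's inequality, instead of a union bound, avoids a logarithmic factor.
\<close>

lemma eliminated_signal_le:
  assumes r: "r < R" and h: "length h = N"
    and k: "k \<in> set (active r h)" "k \<notin> set (active (Suc r) h)"
  shows "(real (L r) * (\<kappa> * \<theta> k))\<^sup>2 \<le>
    4 * ((noise r k h)\<^sup>2 + (\<Sum>l<d. (noise r l h)\<^sup>2) / (real (K (Suc r)) - real s))"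
proof -
  let ?a = "\<bar>real (L r) * (\<kappa> * \<theta> k)\<bar>" and ?Y = "total r (active r h) h"
  have pos: "0 < real (K (Suc r)) - real s"
    using K_large[OF r] by simp
  have S: "0 \<le> (\<Sum>l<d. (noise r l h)\<^sup>2) / (real (K (Suc r)) - real s)"
    using pos by (intro divide_nonneg_pos sum_nonneg) auto
  show ?thesis
  proof (cases "?a / 2 \<le> \<bar>noise r k h\<bar>")
    case True
    then have "(?a / 2)\<^sup>2 \<le> \<bar>noise r k h\<bar>\<^sup>2"
      by (intro power_mono) auto
    then show ?thesis
      using S by (simp add: power_divide)
  next
    case False
    have Yk: "?a / 2 \<le> \<bar>?Y k\<bar>"
      using False noise_eq[OF less_imp_le[OF r] h k(1)] by linarith
    let ?U = "{k\<in>{..<d}. \<theta> k \<noteq> 0}" and ?B = "set (active (Suc r) h)"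
    have B: "?B \<subseteq> {..<d}" "card ?B = K (Suc r)"
      using active_less[of "Suc r" _ h] length_active[of "Suc r" h] distinct_active[of "Suc r" h] r
      by (auto simp: distinct_card simp del: active.simps)
    \<comment> \<open>For such \<open>l\<close> the total is pure noise, and by the sorting it is at
      least as large as the total of the dropped \<open>k\<close>.\<close>
    have null: "(?a / 2)\<^sup>2 \<le> (noise r l h)\<^sup>2" if l: "l \<in> ?B - ?U" for l
    proof -
      have "l \<in> set (active r h)"
        using l active_Suc_subset by blast
      then have "?Y l = noise r l h"
        using noise_eq[OF less_imp_le[OF r] h, of l] l B(1) by auto
      moreover have "\<bar>?Y k\<bar> \<le> \<bar>?Y l\<bar>"
        using sort_key_take_le[of l "K (Suc r)" "\<lambda>k. - \<bar>?Y k\<bar>" "active r h" k] k l by simp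
      ultimately have "?a / 2 \<le> \<bar>noise r l h\<bar>"
        using Yk by simp
      then have "(?a / 2)\<^sup>2 \<le> \<bar>noise r l h\<bar>\<^sup>2"
        by (intro power_mono) auto
      then show ?thesis by simp
    qed
    have "(real (K (Suc r)) - real s) * (?a / 2)\<^sup>2 \<le> real (card (?B - ?U)) * (?a / 2)\<^sup>2"
    proof (intro mult_right_mono)
      have "K (Suc r) - s \<le> card ?B - card ?U"
        using B(2) sparse by simp
      also have "\<dots> \<le> card (?B - ?U)"
        by (intro diff_card_le_card_Diff) simp
      finally show "real (K (Suc r)) - real s \<le> real (card (?B - ?U))"
        by linarith
    qed simp
    also have "\<dots> = (\<Sum>l\<in>?B - ?U. (?a / 2)\<^sup>2)"
      by simp
    also have "\<dots> \<le> (\<Sum>l\<in>?B - ?U. (noise r l h)\<^sup>2)"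
      by (intro sum_mono null)
    also have "\<dots> \<le> (\<Sum>l<d. (noise r l h)\<^sup>2)"
      using B(1) by (intro sum_mono2) auto
    finally have "(?a / 2)\<^sup>2 \<le> (\<Sum>l<d. (noise r l h)\<^sup>2) / (real (K (Suc r)) - real s)"
      using pos by (simp add: pos_le_divide_eq mult.commute)
    then have "?a\<^sup>2 \<le> 4 * ((\<Sum>l<d. (noise r l h)\<^sup>2) / (real (K (Suc r)) - real s))"
      by (simp add: power_divide mult.commute)
    then show ?thesis
      using zero_le_power2[of "noise r k h"] by (simp add: distrib_left add_increasing)
  qed
qed

text \<open>A survivor pays its noise of the last stage. A dropped coordinate pays its squared
  signal, charged to the stage that dropped it; as this stage is random, the bound sums over all of
  them. Dropping a null coordinate is free, so the second sum runs over the support only.\<close>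

lemma loss_le:
  assumes h: "length h = N"
  shows "(\<Sum>k<d. (\<theta> k - estimate \<kappa> h k)\<^sup>2) \<le>
    (\<Sum>k<d. (noise R k h)\<^sup>2) / (real (L R) * \<kappa>)\<^sup>2 +
    (\<Sum>k\<in>{k\<in>{..<d}. \<theta> k \<noteq> 0}. \<Sum>r<R. 4 / (real (L r) * \<kappa>)\<^sup>2 *
      ((noise r k h)\<^sup>2 + (\<Sum>l<d. (noise r l h)\<^sup>2) / (real (K (Suc r)) - real s)))"
    (is "_ \<le> ?A + (\<Sum>k\<in>?U. \<Sum>r<R. ?T r k)")
proof -
  have T: "0 \<le> ?T r k" if "r < R" for r k
    using K_large[OF that] by (intro mult_nonneg_nonneg add_nonneg_nonneg divide_nonneg_nonneg sum_nonneg) auto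
  have "(\<theta> k - estimate \<kappa> h k)\<^sup>2 \<le> (noise R k h)\<^sup>2 / (real (L R) * \<kappa>)\<^sup>2 +
      of_bool (\<theta> k \<noteq> 0) * (\<Sum>r<R. ?T r k)" if k: "k < d" for k
  proof (cases "k \<in> set (active R h)")
    case True
    have "\<theta> k - estimate \<kappa> h k = - (noise R k h / (real (L R) * \<kappa>))"
      using True noise_eq[OF order.refl h True] \<kappa>_nonzero L_pos[of R]
      by (simp add: estimate_def field_simps)
    then have "(\<theta> k - estimate \<kappa> h k)\<^sup>2 = (noise R k h)\<^sup>2 / (real (L R) * \<kappa>)\<^sup>2"
      by (simp add: power_divide)
    moreover have "0 \<le> of_bool (\<theta> k \<noteq> 0) * (\<Sum>r<R. ?T r k)"
      using sum_nonneg[of "{..<R}" "\<lambda>r. ?T r k"] T by simp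
    ultimately show ?thesis
      by linarith
  next
    case False
    then obtain r where r: "r < R" "k \<in> set (active r h)" "k \<notin> set (active (Suc r) h)"
      using eliminated_stage[OF k] by blast
    have Lk: "0 < (real (L r) * \<kappa>)\<^sup>2"
      using \<kappa>_nonzero L_pos[of r] by simp
    have "(\<theta> k)\<^sup>2 = (real (L r) * (\<kappa> * \<theta> k))\<^sup>2 / (real (L r) * \<kappa>)\<^sup>2"
      using \<kappa>_nonzero L_pos[of r] by (simp add: power_mult_distrib)
    also have "\<dots> \<le> ?T r k"
      using divide_right_mono[OF eliminated_signal_le[OF r(1) h r(2,3)] less_imp_le[OF Lk]] by simp
    also have "\<dots> \<le> (\<Sum>r<R. ?T r k)"
      using T r(1) by (intro member_le_sum) auto
    finally have "(\<theta> k)\<^sup>2 \<le> of_bool (\<theta> k \<noteq> 0) * (\<Sum>r<R. ?T r k)"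
      by (cases "\<theta> k = 0") auto
    moreover have "0 \<le> (noise R k h)\<^sup>2 / (real (L R) * \<kappa>)\<^sup>2"
      by simp
    moreover have "(\<theta> k - estimate \<kappa> h k)\<^sup>2 = (\<theta> k)\<^sup>2"
      using False by (simp add: estimate_def)
    ultimately show ?thesis
      by linarith
  qed
  then have "(\<Sum>k<d. (\<theta> k - estimate \<kappa> h k)\<^sup>2) \<le>
      (\<Sum>k<d. (noise R k h)\<^sup>2 / (real (L R) * \<kappa>)\<^sup>2 + of_bool (\<theta> k \<noteq> 0) * (\<Sum>r<R. ?T r k))"
    by (intro sum_mono) simp
  also have "\<dots> = ?A + (\<Sum>k<d. of_bool (\<theta> k \<noteq> 0) * (\<Sum>r<R. ?T r k))"
    by (simp add: sum.distrib sum_divide_distrib)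
  also have "(\<Sum>k<d. of_bool (\<theta> k \<noteq> 0) * (\<Sum>r<R. ?T r k)) = (\<Sum>k\<in>?U. \<Sum>r<R. ?T r k)"
    by (intro sum.mono_neutral_cong_right) auto
  finally show ?thesis .
qed

text \<open>The pathwise bound is linear in the squared noises, so second moments stage by stage
  suffice and no independence between stages is used.\<close>

lemma expect_loss_le:
  "expect N (\<lambda>h. \<Sum>k<d. (\<theta> k - estimate \<kappa> h k)\<^sup>2) \<le>
    real (K R) / (real (L R) * \<kappa>\<^sup>2) +
    real s * (\<Sum>r<R. 4 / (real (L r) * \<kappa>\<^sup>2) * (1 + real (K r) / (real (K (Suc r)) - real s)))"
proof -
  let ?U = "{k\<in>{..<d}. \<theta> k \<noteq> 0}"
  let ?c = "\<lambda>r. 4 / (real (L r) * \<kappa>)\<^sup>2" and ?g = "\<lambda>r. real (K (Suc r)) - real s"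
  let ?V = "\<lambda>r. 4 / (real (L r) * \<kappa>\<^sup>2) * (1 + real (K r) / ?g r)"
  have "expect N (\<lambda>h. \<Sum>k<d. (\<theta> k - estimate \<kappa> h k)\<^sup>2) \<le> expect N (\<lambda>h.
      1 / (real (L R) * \<kappa>)\<^sup>2 * (\<Sum>k<d. (noise R k h)\<^sup>2) +
      (\<Sum>k\<in>?U. \<Sum>r<R. ?c r * ((noise r k h)\<^sup>2 + 1 / ?g r * (\<Sum>l<d. (noise r l h)\<^sup>2))))"
    by (intro expect_mono) (use loss_le in simp)
  also have "\<dots> = 1 / (real (L R) * \<kappa>)\<^sup>2 * expect N (\<lambda>h. \<Sum>k<d. (noise R k h)\<^sup>2) +
      (\<Sum>k\<in>?U. \<Sum>r<R. ?c r * (expect N (\<lambda>h. (noise r k h)\<^sup>2) +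
        1 / ?g r * expect N (\<lambda>h. \<Sum>l<d. (noise r l h)\<^sup>2)))"
    by (simp only: expect_add expect_mult expect_sum[where I = ?U] expect_sum[where I = "{..<R}"])
  also have "\<dots> \<le> 1 / (real (L R) * \<kappa>)\<^sup>2 * (real (K R) * real (L R)) +
      (\<Sum>k\<in>?U. \<Sum>r<R. ?c r * (real (L r) + 1 / ?g r * (real (K r) * real (L r))))"
    using K_large
    by (intro add_mono mult_left_mono sum_mono expect_sum_noise_square_le expect_noise_square_le) (auto simp: less_imp_le)
  also have "\<dots> = real (K R) / (real (L R) * \<kappa>\<^sup>2) + real (card ?U) * (\<Sum>r<R. ?V r)"
  proof -
    have "1 / (real (L R) * \<kappa>)\<^sup>2 * (real (K R) * real (L R)) = real (K R) / (real (L R) * \<kappa>\<^sup>2)"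
      using L_pos[of R] \<kappa>_nonzero by (simp add: power2_eq_square field_simps)
    moreover have "?c r * (real (L r) + 1 / ?g r * (real (K r) * real (L r))) = ?V r" for r
    proof -
      have "real (L r) + 1 / ?g r * (real (K r) * real (L r)) = real (L r) * (1 + real (K r) / ?g r)"
        by (simp add: distrib_left)
      moreover have "?c r * real (L r) = 4 / (real (L r) * \<kappa>\<^sup>2)"
        using L_pos[of r] \<kappa>_nonzero by (simp add: power2_eq_square field_simps)
      ultimately show ?thesis
        by (simp only: mult.assoc[symmetric])
    qed
    ultimately show ?thesis
      by simp
  qed
  also have "\<dots> \<le> real (K R) / (real (L R) * \<kappa>\<^sup>2) + real s * (\<Sum>r<R. ?V r)"
    using sparse K_large
    by (intro add_left_mono mult_right_mono sum_nonneg mult_nonneg_nonneg add_nonneg_nonneg divide_nonneg_nonneg)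
       (auto simp: less_imp_le)
  finally show ?thesis .
qed

end

section \<open>The rate\<close>

text \<open>The remainder is at most 3, hence at most three times the positive quotient.\<close>

lemma div_le_7_mult_div:
  fixes x :: nat
  assumes "0 < x div 4"
  shows "x \<le> 7 * (x div 4)"
  using assms by linarith

lemma sum_half_powers_le: "(\<Sum>r<n. 1 / 2 ^ r :: real) \<le> 2"
proof -
  have "(\<Sum>r<n. 1 / 2 ^ r :: real) = 2 - 2 / 2 ^ n"
    by (induction n) (simp_all add: field_simps)
  then show ?thesis by simp
qed

text \<open>
  The number of surviving coordinates shrinks by the factor 4 in each stage while the number of
  queries per coordinate doubles. Both the number of queries and the contributions of the stages to
  the error are then geometric series.
\<close>

lemma elimination_parameters:
  fixes d s N :: nat
  assumes s: "1 \<le> s" "s \<le> d" and N: "2 * d \<le> N"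
  obtains K L :: "nat \<Rightarrow> nat" and R :: nat
  where "elimination d R K L"
    and "elimination.start K L (Suc R) \<le> N"
    and "\<And>r. r < R \<Longrightarrow> s < K (Suc r)"
    and "\<And>\<kappa>::real. \<kappa> \<noteq> 0 \<Longrightarrow> real (K R) / (real (L R) * \<kappa>\<^sup>2) +
        real s * (\<Sum>r<R. 4 / (real (L r) * \<kappa>\<^sup>2) * (1 + real (K r) / (real (K (Suc r)) - real s)))
      \<le> 512 * (real s * real d) / (real N * \<kappa>\<^sup>2)"
proof -
  \<comment> \<open>Stage \<open>r\<close> costs at most \<open>d * b / 2 ^ r\<close> queries, so
    all stages together cost at most \<open>2 * d * b \<le> N\<close>.\<close>
  define b where "b = N div (2 * d)"
  define K where "K r = d div 4 ^ r" for r :: nat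
  define L where "L r = b * 2 ^ r" for r :: nat
  \<comment> \<open>Stopping at \<open>2 * s\<close> rather than \<open>s\<close> leaves at least
    half of the kept coordinates null in every selecting stage, and still gives
    \<open>K R \<le> 8 * s\<close>.\<close>
  define R where "R = (LEAST r. K (Suc r) < 2 * s)"
  have b: "0 < b"
    using s N by (simp add: b_def div_greater_zero_iff)
  \<comment> \<open>Ensures that the least index exists: \<open>K (Suc d)\<close> is 0.\<close>
  have "K (Suc d) < 2 * s"
  proof -
    have "d < 4 ^ Suc d"
      using less_exp[of "Suc d"] power_mono[of "2::nat" 4 "Suc d"] by simp
    then show ?thesis
      using s by (simp add: K_def)
  qed
  then have KR: "K (Suc R) < 2 * s"
    unfolding R_def by (rule LeastI)
  have large: "2 * s \<le> K (Suc r)" if "r < R" for r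
    using not_less_Least[of r "\<lambda>r. K (Suc r) < 2 * s"] that by (simp add: R_def)
  have K_quarter: "K (Suc r) = K r div 4" for r
    by (simp add: K_def div_mult2_eq[symmetric] mult.commute)
  interpret elimination d R K L
    by standard (use b s in \<open>auto simp: L_def K_quarter\<close>, simp add: K_def)
  have KL: "real (K r * L r) \<le> real d * real b * (1 / 2 ^ r)" for r
  proof -
    have "real (K r) \<le> real d / 4 ^ r"
      unfolding K_def using of_nat_div_le_of_nat[of d "4 ^ r", where ?'a = real] by simp
    then have "real (K r) * (real b * 2 ^ r) \<le> real d / 4 ^ r * (real b * 2 ^ r)"
      by (intro mult_right_mono) auto
    also have "\<dots> = real d * real b * (1 / 2 ^ r)"
      using power_mult_distrib[of "2::real" 2 r] by (simp add: field_simps)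
    finally show ?thesis
      by (simp add: L_def)
  qed
  have "real (start (Suc R)) \<le> (\<Sum>r<Suc R. real d * real b * (1 / 2 ^ r))"
    unfolding start_def of_nat_sum by (intro sum_mono KL)
  also have "\<dots> \<le> real d * real b * 2"
    unfolding sum_distrib_left[symmetric] by (intro mult_left_mono sum_half_powers_le) simp
  also have "\<dots> = real (2 * d * b)"
    by simp
  also have "2 * d * b \<le> N"
    unfolding b_def by (simp add: mult.commute)
  finally have start: "start (Suc R) \<le> N"
    by simp
  have error: "real (K R) / (real (L R) * \<kappa>\<^sup>2) +
        real s * (\<Sum>r<R. 4 / (real (L r) * \<kappa>\<^sup>2) * (1 + real (K r) / (real (K (Suc r)) - real s)))
      \<le> 512 * (real s * real d) / (real N * \<kappa>\<^sup>2)" if \<kappa>: "\<kappa> \<noteq> 0" for \<kappa> :: real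
  proof -
    let ?q = "1 / (real b * \<kappa>\<^sup>2)"
    have q: "0 \<le> ?q" by simp
    have "real (K R) / (real (L R) * \<kappa>\<^sup>2) \<le> real (8 * s) * ?q"
    proof -
      have "K R \<le> 8 * s"
        using KR unfolding K_quarter by linarith
      moreover have "1 / (real (L R) * \<kappa>\<^sup>2) \<le> ?q"
        using b \<kappa> by (intro divide_left_mono mult_right_mono) (auto simp: L_def)
      ultimately have "real (K R) * (1 / (real (L R) * \<kappa>\<^sup>2)) \<le> real (8 * s) * ?q"
        by (intro mult_mono) auto
      then show ?thesis by simp
    qed
    moreover have "(\<Sum>r<R. 4 / (real (L r) * \<kappa>\<^sup>2) * (1 + real (K r) / (real (K (Suc r)) - real s)))
        \<le> 120 * ?q"
    proof -
      have "4 / (real (L r) * \<kappa>\<^sup>2) * (1 + real (K r) / (real (K (Suc r)) - real s))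
          \<le> 60 * ?q * (1 / 2 ^ r)" if r: "r < R" for r
      proof -
        have "real (K r) \<le> 7 * real (K (Suc r))"
          using div_le_7_mult_div[of "K r"] large[OF r] s(1) unfolding K_quarter by linarith
        moreover have "2 * real s \<le> real (K (Suc r))"
          using large[OF r] by linarith
        moreover have "0 < real s"
          using s(1) by simp
        \<comment> \<open>\<open>K (Suc r) - s\<close> is at least half of \<open>K (Suc r)\<close>,
          so the quotient is at most 2 * 7 = 14. Together with the factor 4 and the geometric sum 2
          this yields 4 * 15 * 2 = 120.\<close>
        ultimately have "1 + real (K r) / (real (K (Suc r)) - real s) \<le> 15"
          by (simp add: field_simps)
        then have "4 / (real (L r) * \<kappa>\<^sup>2) * (1 + real (K r) / (real (K (Suc r)) - real s))
            \<le> 4 / (real (L r) * \<kappa>\<^sup>2) * 15"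
          by (intro mult_left_mono) auto
        also have "\<dots> = 60 * ?q * (1 / 2 ^ r)"
          by (simp add: L_def)
        finally show ?thesis .
      qed
      then have "(\<Sum>r<R. 4 / (real (L r) * \<kappa>\<^sup>2) * (1 + real (K r) / (real (K (Suc r)) - real s)))
          \<le> (\<Sum>r<R. 60 * ?q * (1 / 2 ^ r))"
        by (intro sum_mono) simp
      also have "\<dots> \<le> 60 * ?q * 2"
        unfolding sum_distrib_left[symmetric] by (intro mult_left_mono sum_half_powers_le) simp
      finally show ?thesis by simp
    qed
    then have "real s * (\<Sum>r<R. 4 / (real (L r) * \<kappa>\<^sup>2) * (1 + real (K r) / (real (K (Suc r)) - real s)))
        \<le> real s * (120 * ?q)"
      by (intro mult_left_mono) auto
    ultimately have "real (K R) / (real (L R) * \<kappa>\<^sup>2) +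
        real s * (\<Sum>r<R. 4 / (real (L r) * \<kappa>\<^sup>2) * (1 + real (K r) / (real (K (Suc r)) - real s)))
      \<le> real (8 * s) * ?q + real s * (120 * ?q)"
      by (rule add_mono)
    also have "\<dots> = 128 * real s * ?q"
      by simp
    also have "\<dots> \<le> 128 * real s * (4 * real d / (real N * \<kappa>\<^sup>2))"
    proof (intro mult_left_mono)
      \<comment> \<open>Rounding down in \<open>b\<close> loses at most a factor 2, so
        \<open>1 / b\<close> is at most \<open>4 * d / N\<close>; this turns 8 + 120 = 128 into
        512.\<close>
      have "N < 2 * d * (b + 1)"
        unfolding b_def using s dividend_less_times_div[of "2 * d" N] by simp
      also have "\<dots> \<le> 2 * d * (2 * b)"
        using b by (intro mult_left_mono) auto
      finally have "real N \<le> real (2 * d * (2 * b))"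
        by (intro of_nat_mono) simp
      then have "real N \<le> 4 * real d * real b"
        by simp
      moreover have "0 < real N"
        using N s by simp
      ultimately show "?q \<le> 4 * real d / (real N * \<kappa>\<^sup>2)"
        using b \<kappa> by (simp add: field_simps)
    qed simp
    finally show ?thesis
      by simp
  qed
  show ?thesis
    by (rule that[of R K L]) (use start error large s in \<open>fastforce intro: elimination_axioms\<close>)+
qed

section \<open>Inverting the sine, and the choice of the bias\<close>

lemma abs_diff_le_sin_diff:
  fixes x y :: real
  assumes "\<bar>x\<bar> \<le> 1" "\<bar>y\<bar> \<le> 1"
  shows "cos 1 * \<bar>x - y\<bar> \<le> \<bar>sin x - sin y\<bar>"
proof -
  \<comment> \<open>The cosine is the slope in the mean value theorem, and on the range of the means
    it stays above \<open>cos 1 > 0\<close>, as 1 is below pi / 2.\<close>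
  have cos_ge: "cos 1 \<le> cos z" if "\<bar>z\<bar> \<le> 1" for z :: real
    using cos_monotone_0_pi_le[of "\<bar>z\<bar>" 1] that pi_gt3 by simp
  have *: "cos 1 * (v - u) \<le> sin v - sin u" if "u < v" "\<bar>u\<bar> \<le> 1" "\<bar>v\<bar> \<le> 1" for u v :: real
  proof -
    have "\<exists>z>u. z < v \<and> sin v - sin u = (v - u) * cos z"
      by (rule MVT2[OF that(1)]) (rule DERIV_sin)
    then obtain z where z: "u < z" "z < v" "sin v - sin u = (v - u) * cos z"
      by blast
    then have "\<bar>z\<bar> \<le> 1"
      using that by linarith
    from mult_right_mono[OF cos_ge[OF this], of "v - u"] z that(1) show ?thesis
      by (simp add: mult.commute)
  qed
  show ?thesis
    using *[of x y] *[of y x] assms by (cases x y rule: linorder_cases) (auto simp: abs_if)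
qed

lemma cos_1_pos: "0 < cos (1::real)"
  using cos_gt_zero[of 1] pi_gt3 by simp

definition arcsin_clip :: "real \<Rightarrow> real" where
  "arcsin_clip y = arcsin (max (- sin 1) (min (sin 1) y))"

text \<open>Clipping projects onto an interval that contains \<open>sin x\<close>, so it cannot
  increase the error, and it forces the result into [-1, 1], where the sine has a Lipschitz
  inverse.\<close>

lemma arcsin_clip_error:
  assumes "\<bar>x\<bar> \<le> 1"
  shows "(x - arcsin_clip y)\<^sup>2 \<le> (sin x - y)\<^sup>2 / (cos 1)\<^sup>2"
proof -
  let ?y = "max (- sin 1) (min (sin 1) y)"
  have pi: "1 < pi / 2" using pi_gt3 by simp
  have sin1: "0 < sin (1::real)"
    using sin_gt_zero[of 1] pi_gt3 by simp
  have range: "- sin 1 \<le> ?y" "?y \<le> sin 1"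
    using sin1 by auto
  then have y: "\<bar>?y\<bar> \<le> 1"
    using sin_le_one[of "1::real"] by linarith
  have "arcsin ?y \<le> arcsin (sin 1)" "arcsin (- sin 1) \<le> arcsin ?y"
    using range y by (auto intro!: arcsin_le_arcsin)
  then have le1: "\<bar>arcsin_clip y\<bar> \<le> 1"
    using pi by (simp add: arcsin_clip_def arcsin_sin arcsin_minus)
  have sin_eq: "sin (arcsin_clip y) = ?y"
    unfolding arcsin_clip_def using y by (intro sin_arcsin) auto
  have "- sin 1 \<le> sin x" "sin x \<le> sin 1"
    using sin_monotone_2pi_le[of x 1] sin_monotone_2pi_le[of "-1" x] assms pi by auto
  then have "\<bar>sin x - ?y\<bar> \<le> \<bar>sin x - y\<bar>"
    by auto
  then have "cos 1 * \<bar>x - arcsin_clip y\<bar> \<le> \<bar>sin x - y\<bar>"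
    using abs_diff_le_sin_diff[OF assms le1] sin_eq by simp
  then have "(cos 1 * \<bar>x - arcsin_clip y\<bar>)\<^sup>2 \<le> \<bar>sin x - y\<bar>\<^sup>2"
    using cos_1_pos by (intro power_mono mult_nonneg_nonneg) auto
  then show ?thesis
    using cos_1_pos by (simp add: power_mult_distrib field_simps)
qed

text \<open>This \<alpha> makes the ratio \<open>(1 + \<alpha>) / (1 - \<alpha>)\<close> equal to
  \<open>1 + \<epsilon> \<le> exp \<epsilon>\<close>, and it remains of order \<epsilon> while
  \<epsilon> is bounded.\<close>

lemma response_bias:
  fixes \<epsilon> :: real
  assumes "0 < \<epsilon>"
  defines "\<alpha> \<equiv> \<epsilon> / (2 + \<epsilon>)"
  shows "0 < \<alpha>" "\<alpha> \<le> 1" "1 + \<bar>\<alpha>\<bar> \<le> exp \<epsilon> * (1 - \<bar>\<alpha>\<bar>)"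
proof -
  show pos: "0 < \<alpha>" "\<alpha> \<le> 1"
    using assms by (simp_all add: \<alpha>_def)
  have "1 + \<bar>\<alpha>\<bar> = (1 + \<epsilon>) * (1 - \<bar>\<alpha>\<bar>)"
    using assms(1) by (simp add: \<alpha>_def field_simps)
  also have "\<dots> \<le> exp \<epsilon> * (1 - \<bar>\<alpha>\<bar>)"
    using pos exp_ge_add_one_self[of \<epsilon>] by (intro mult_right_mono) auto
  finally show "1 + \<bar>\<alpha>\<bar> \<le> exp \<epsilon> * (1 - \<bar>\<alpha>\<bar>)" .
qed

lemma abs_le_linf_norm: "k < d \<Longrightarrow> \<bar>v k\<bar> \<le> linf_norm d v"
  unfolding linf_norm_def by (intro Max_ge) auto


text \<open>The bridge from the federated risk to the bandit, whose bit law is exactly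
  \<open>mean_weight \<mu>\<close>.\<close>

lemma (in sequential_protocol) risk_protocol_le:
  assumes "bandit.expect qry (\<alpha> * exp (- 1 / 2)) (\<lambda>k. sin (\<mu> k)) (m * n)
    (\<lambda>h. \<Sum>k<d. (\<mu> k - est h k)\<^sup>2) \<le> c"
  shows "risk m n d \<mu> protocol \<le> ennreal c"
proof -
  interpret bandit qry "\<alpha> * exp (- 1 / 2)" "\<lambda>k. sin (\<mu> k)"
    by standard (simp add: abs_mult \<alpha> mult_le_one)
  have "mean_weight \<mu> = bit_prob"
    unfolding fun_eq_iff mean_weight_def bit_prob_def response_prob_def
    by (intro allI) (simp only: mult.assoc)
  then show ?thesis
    unfolding risk_protocol using assms[unfolded expect_def] by (simp only: ennreal_leI)
qed

theorem theorem2: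
  fixes \<epsilon>\<^sub>0 :: real
  assumes "\<epsilon>\<^sub>0 > 0"
  shows "\<exists>c::real. c > 0 \<and>
    (\<forall>(m::nat) (n::nat) (d::nat) (s::nat) (\<epsilon>::real).
      m \<ge> 1 \<and> n \<ge> 1 \<and> d \<ge> 1 \<and> 1 \<le> s \<and> s \<le> d \<and> 0 < \<epsilon> \<and> \<epsilon> \<le> \<epsilon>\<^sub>0 \<longrightarrow>
      (\<exists>P :: (real, real) fed_algorithm.
        private_fed_algorithm \<epsilon> m n d P \<and>
        (\<forall>\<mu>\<in>space (vec_space d). l0_norm d \<mu> \<le> s \<and> linf_norm d \<mu> \<le> 1 \<longrightarrow>
          risk m n d \<mu> P \<le> ennreal (c * (real s * real d / (real m * real n * \<epsilon>\<^sup>2))))))"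
proof -
  \<comment> \<open>For \<open>m * n < 2 * d\<close> the zero estimator loses at most
    \<open>s\<close>, and \<open>m * n * \<epsilon>\<^sup>2 \<le> 2 * d *
    \<epsilon>\<^sub>0\<^sup>2\<close>, so \<open>c1\<close> times the rate is at least
    \<open>s\<close>.\<close>
  define c1 where "c1 = 2 * \<epsilon>\<^sub>0\<^sup>2"
  \<comment> \<open>512 comes from elimination,
    \<open>exp 1 * (2 + \<epsilon>\<^sub>0)\<^sup>2\<close> bounds
    \<open>\<epsilon>\<^sup>2 / \<kappa>\<^sup>2\<close>, and \<open>1 / (cos 1)\<^sup>2\<close> is
    the price of inverting the sine.\<close>
  define c2 where "c2 = 512 * exp 1 * (2 + \<epsilon>\<^sub>0)\<^sup>2 / (cos 1)\<^sup>2"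
  have c_pos: "0 < c1" "0 \<le> c2"
    using assms by (simp_all add: c1_def c2_def)
  have main: "\<exists>P :: (real, real) fed_algorithm. private_fed_algorithm \<epsilon> m n d P \<and>
        (\<forall>\<mu>\<in>space (vec_space d). l0_norm d \<mu> \<le> s \<and> linf_norm d \<mu> \<le> 1 \<longrightarrow>
          risk m n d \<mu> P \<le> ennreal ((c1 + c2) * (real s * real d / (real m * real n * \<epsilon>\<^sup>2))))"
    if mn: "m \<ge> 1" "n \<ge> 1" and s: "1 \<le> s" "s \<le> d" and \<epsilon>: "0 < \<epsilon>" "\<epsilon> \<le> \<epsilon>\<^sub>0"
    for m n d s :: nat and \<epsilon> :: real
  proof -
    define \<alpha> where "\<alpha> = \<epsilon> / (2 + \<epsilon>)"
    define \<kappa> where "\<kappa> = \<alpha> * exp (- 1 / 2)"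
    note bias = response_bias[OF \<epsilon>(1), folded \<alpha>_def]
    have rate_pos: "0 < real m * real n * \<epsilon>\<^sup>2"
      using mn \<epsilon> by simp
    have bounded: "\<bar>\<mu> k\<bar> \<le> 1" if "linf_norm d \<mu> \<le> 1" "k < d" for \<mu> k
      using abs_le_linf_norm[OF that(2), of \<mu>] that(1) by simp
    have abs_\<kappa>: "\<bar>\<kappa> * sin x\<bar> \<le> 1" for x
      using bias by (simp add: \<kappa>_def abs_mult mult_le_one)
    show ?thesis
    proof (cases "m * n < 2 * d")
      case True
      \<comment> \<open>The machines still answer, but the estimator ignores the replies; any query
        would do.\<close>
      interpret sequential_protocol m n d \<alpha> "\<lambda>_. 0" "\<lambda>_. \<lambda>k\<in>{..<d}. 0"
        by standard (use bias s in \<open>auto simp: vec_space_def space_PiM\<close>)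
      have "risk m n d \<mu> protocol \<le> ennreal ((c1 + c2) * (real s * real d / (real m * real n * \<epsilon>\<^sup>2)))"
        if \<mu>: "l0_norm d \<mu> \<le> s" "linf_norm d \<mu> \<le> 1" for \<mu>
      proof (rule risk_protocol_le, fold \<kappa>_def)
        interpret bandit "\<lambda>_. 0" \<kappa> "\<lambda>k. sin (\<mu> k)"
          by standard (rule abs_\<kappa>)
        have "(\<Sum>k<d. (\<mu> k)\<^sup>2) \<le> (\<Sum>k<d. of_bool (\<mu> k \<noteq> 0))"
          using bounded[OF \<mu>(2)] by (intro sum_mono) (auto simp: abs_square_le_1)
        also have "\<dots> = real (l0_norm d \<mu>)"
          by (simp add: l0_norm_def sum_of_bool_eq Int_def)
        also have "\<dots> \<le> real s * 1"
          using \<mu>(1) by simp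
        also have "\<dots> \<le> real s * ((c1 + c2) * (real d / (real m * real n * \<epsilon>\<^sup>2)))"
        proof (intro mult_left_mono)
          have "real m * real n * \<epsilon>\<^sup>2 \<le> (2 * real d) * \<epsilon>\<^sub>0\<^sup>2"
            using True \<epsilon> of_nat_mono[of "m * n" "2 * d", where ?'a = real]
            by (intro mult_mono[of "real m * real n"] power_mono) auto
          also have "\<dots> \<le> (c1 + c2) * real d"
            using c_pos by (simp add: c1_def distrib_right)
          finally show "1 \<le> (c1 + c2) * (real d / (real m * real n * \<epsilon>\<^sup>2))"
            using rate_pos by simp
        qed simp
        finally show "expect (m * n) (\<lambda>h. \<Sum>k<d. (\<mu> k - (\<lambda>k\<in>{..<d}. 0) k)\<^sup>2)
            \<le> (c1 + c2) * (real s * real d / (real m * real n * \<epsilon>\<^sup>2))"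
          by (simp add: expect_const ac_simps)
      qed
      then show ?thesis
        using private_fed_algorithm_protocol[OF bias(3)] \<epsilon>(1) by (intro exI[of _ protocol]) auto
    next
      case False
      then have N: "2 * d \<le> m * n" by simp
      obtain K L R where
        elim: "elimination d R K L" and budget: "elimination.start K L (Suc R) \<le> m * n"
        and K_large: "\<And>r. r < R \<Longrightarrow> s < K (Suc r)"
        and error: "\<And>\<kappa>::real. \<kappa> \<noteq> 0 \<Longrightarrow> real (K R) / (real (L R) * \<kappa>\<^sup>2) +
          real s * (\<Sum>r<R. 4 / (real (L r) * \<kappa>\<^sup>2) * (1 + real (K r) / (real (K (Suc r)) - real s)))
          \<le> 512 * (real s * real d) / (real (m * n) * \<kappa>\<^sup>2)"
        by (rule elimination_parameters[OF s N]) (rule that)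
      interpret elimination d R K L
        by (rule elim)
      let ?est = "\<lambda>h. \<lambda>k\<in>{..<d}. arcsin_clip (estimate \<kappa> h k)"
      interpret sequential_protocol m n d \<alpha> query ?est
        by standard (use bias in \<open>simp_all add: query_less vec_space_def space_PiM\<close>)
      have "risk m n d \<mu> protocol \<le> ennreal ((c1 + c2) * (real s * real d / (real m * real n * \<epsilon>\<^sup>2)))"
        if \<mu>: "l0_norm d \<mu> \<le> s" "linf_norm d \<mu> \<le> 1" for \<mu>
      proof (rule risk_protocol_le, fold \<kappa>_def)
        have \<kappa>: "\<kappa> \<noteq> 0"
          using bias by (simp add: \<kappa>_def)
        \<comment> \<open>The sine vanishes at 0, so passing from \<mu> to its sine does not enlarge
          the support.\<close>
        have "card {k\<in>{..<d}. sin (\<mu> k) \<noteq> 0} \<le> card {k\<in>{..<d}. \<mu> k \<noteq> 0}"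
          by (intro card_mono) auto
        then have sparse: "card {k\<in>{..<d}. sin (\<mu> k) \<noteq> 0} \<le> s"
          using \<mu>(1) by (simp add: l0_norm_def)
        interpret elimination_bandit d R K L \<kappa> "\<lambda>k. sin (\<mu> k)" "m * n" s
          by unfold_locales (fact abs_\<kappa> budget sparse K_large \<kappa>)+
        have "expect (m * n) (\<lambda>h. \<Sum>k<d. (\<mu> k - ?est h k)\<^sup>2) \<le>
            expect (m * n) (\<lambda>h. 1 / (cos 1)\<^sup>2 * (\<Sum>k<d. (sin (\<mu> k) - estimate \<kappa> h k)\<^sup>2))"
          unfolding sum_distrib_left
          using arcsin_clip_error[OF bounded[OF \<mu>(2)]] by (intro expect_mono sum_mono) simp
        also have "\<dots> \<le> 1 / (cos 1)\<^sup>2 * (512 * (real s * real d) / (real (m * n) * \<kappa>\<^sup>2))"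
          unfolding expect_mult
          by (rule mult_left_mono[OF order.trans[OF expect_loss_le error[OF \<kappa>]]]) simp
        also have "\<dots> = 512 * exp 1 * (2 + \<epsilon>)\<^sup>2 / (cos 1)\<^sup>2 * (real s * real d / (real m * real n * \<epsilon>\<^sup>2))"
        proof -
          have "exp (- 1 / 2 :: real) ^ 2 = exp (- 1)"
            by (subst exp_double[symmetric]) simp
          then have "\<kappa>\<^sup>2 = \<epsilon>\<^sup>2 / (2 + \<epsilon>)\<^sup>2 * exp (- 1)"
            unfolding \<kappa>_def \<alpha>_def power_mult_distrib power_divide by simp
          then show ?thesis
            by (simp add: exp_minus field_simps)
        qed
        also have "\<dots> \<le> (c1 + c2) * (real s * real d / (real m * real n * \<epsilon>\<^sup>2))"
        proof (intro mult_right_mono)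
          have "512 * exp 1 * (2 + \<epsilon>)\<^sup>2 / (cos 1)\<^sup>2 \<le> c2"
            unfolding c2_def using \<epsilon> by (intro divide_right_mono mult_left_mono power_mono) auto
          then show "512 * exp 1 * (2 + \<epsilon>)\<^sup>2 / (cos 1)\<^sup>2 \<le> c1 + c2"
            using c_pos by simp
        qed simp
        finally show "expect (m * n) (\<lambda>h. \<Sum>k<d. (\<mu> k - ?est h k)\<^sup>2)
            \<le> (c1 + c2) * (real s * real d / (real m * real n * \<epsilon>\<^sup>2))" .
      qed
      then show ?thesis
        using private_fed_algorithm_protocol[OF bias(3)] \<epsilon>(1) by (intro exI[of _ protocol]) auto
    qed
  qed
  show ?thesis
    using c_pos main by (intro exI[of _ "c1 + c2"]) auto
qed

end
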